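(* Each of the following families $F_c$ is an FC-family (i.e., every finite union-closed family $F$ with $F \supseteq F_c$ satisfies the Frankl condition): (1) $F_c = \{\{a\}\}$ for any element $a$; (2) $F_c = \{\{a,b\}\}$ for any elements $a \neq b$; (3) any family $F_c$ consisting of $3$ distinct $3$-element sets whose union has at most $5$ elements; (4) any family $F_c$ consisting of $4$ distinct $3$-element sets whose union has at most $6$ elements; (5) any family $F_c$ consisting of $4$ distinct $3$-element sets whose union has at most $7$ elements.
   Context: All sets and families (sets of sets) are finite. A family $F$ is union closed if $A \cup B \in F$ for all $A, B \in F$. A family $F$ satisfies the Frankl condition (is Frankl's) if there exists $a \in \bigcup F$ with $2\cdot|\{A \in F : a \in A\}| \ge |F|$. A family $F_c$ is an FC-family if every union-closed family $F \supseteq F_c$ satisfies the Frankl condition. *)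

theory Defs
  imports Main
begin

definition union_closed :: "'a set set \<Rightarrow> bool" where
  "union_closed F \<longleftrightarrow> (\<forall>A\<in>F. \<forall>B\<in>F. A \<union> B \<in> F)"

definition frankl :: "'a set set \<Rightarrow> bool" where
  "frankl F \<longleftrightarrow> (\<exists>a\<in>\<Union>F. 2 * card {A \<in> F. a \<in> A} \<ge> card F)"

definition fc_family :: "'a set set \<Rightarrow> bool" where
  "fc_family Fc \<longleftrightarrow>
     (\<forall>F. finite F \<and> (\<forall>A\<in>F. finite A) \<and> union_closed F \<and> Fc \<subseteq> F \<longrightarrow> frankl F)"

end

theory Submission
  imports Defs
begin

text \<open>
  Let \<open>U = \<Union>Fc\<close> and let \<open>w\<close> be positive weights on \<open>U\<close>. The members of a union-closed family
  \<open>F \<supseteq> Fc\<close> are sorted by their part outside \<open>U\<close>; their parts inside \<open>U\<close> then form families \<open>G\<close> of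
  subsets of \<open>U\<close> that are closed under union and under adding a member of \<open>Fc\<close>, and \<open>U \<in> G\<close> whenever
  \<open>G\<close> is not empty. If each such \<open>G\<close> has nonnegative share, the share of \<open>s\<close> being
  \<open>w(s) - w(U - s)\<close>, then the average over \<open>U\<close> of the frequencies in \<open>F\<close>, weighted by \<open>w\<close>, is at least
  one half, so \<open>F\<close> satisfies the Frankl condition (Poonen).

  Nonnegativity of the share is certified by branching on \<open>s \<in> G\<close>. At a leaf the negative shares are
  moved along inclusions \<open>s \<subseteq> s \<union> g\<close>, where \<open>g\<close> is a union of members of \<open>Fc\<close> and of sets assumed to
  lie in \<open>G\<close>, until all are paid for. Up to isomorphism there are four families of three triples on at
  most five points and ten families of four triples on at most seven points no three of which lie on
  five points.
\<close>

subsection \<open>Charging on the cube of subsets\<close>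

text \<open>Closure under joining with a fixed set \<open>g\<close> is a condition on single
  memberships: \<open>s \<in> G\<close> implies \<open>s \<union> g \<in> G\<close>. Minimizing a
  linear function under such implications is a closure problem, dual to a flow along the inclusions,
  which is why a leaf consists of transfers only. Union-closedness is of another kind, since it
  links two unknown members. Assuming \<open>s \<in> G\<close> turns \<open>s\<close> into one more
  fixed set to join with; this is what the branching gains. There is no slack: for all weights the
  full power set of \<open>U\<close> has share 0, because \<open>s\<close> and \<open>U - s\<close>
  cancel, so in the branch where every tested set is present the charging must balance exactly. A
  leaf counts each entry as the smaller of the entry and 0; the knowledge that a set is absent or
  present has to be worked into the entries before, or this estimate is too pessimistic. Sets are
  Boolean lists and all operations are functional programs, so that a certificate is verified by
  evaluation.\<close>

definition join :: "bool list \<Rightarrow> bool list \<Rightarrow> bool list" where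
  "join s t = map2 (\<or>) s t"

lemma join_simps [simp]:
  "join [] t = []" "join s [] = []" "join (a # s) (b # t) = (a \<or> b) # join s t"
  by (simp_all add: join_def)

lemma length_join [simp]: "length (join s t) = min (length s) (length t)"
  by (simp add: join_def)

lemma join_commute: "join s t = join t s"
  by (induction s t rule: list_induct2') auto

lemma join_assoc: "join (join s t) u = join s (join t u)"
proof (induction s t arbitrary: u rule: list_induct2')
  case (4 x xs y ys)
  then show ?case by (cases u) auto
qed auto

lemma join_empty [simp]: "length s = n \<Longrightarrow> join (replicate n False) s = s"
  by (induction s arbitrary: n) auto

text \<open>A tree of depth \<open>n\<close> stores one integer for each subset of \<open>n\<close>
  points, at the end of the path given by its characteristic list. In this form the entries stay
  evaluated, and a transfer along a whole family of parallel inclusions is a single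
  recursion.\<close>

datatype cube = Point int | Split cube cube

fun full :: "nat \<Rightarrow> cube \<Rightarrow> bool" where
  "full 0 (Point a) \<longleftrightarrow> True"
| "full (Suc n) (Split l r) \<longleftrightarrow> full n l \<and> full n r"
| "full _ _ \<longleftrightarrow> False"

lemma full_Point [simp]: "full n (Point a) \<longleftrightarrow> n = 0"
  by (cases n) auto

lemma full_Split [simp]: "full n (Split l r) \<longleftrightarrow> (\<exists>m. n = Suc m \<and> full m l \<and> full m r)"
  by (cases n) auto

fun weight :: "cube \<Rightarrow> (bool list \<Rightarrow> bool) \<Rightarrow> int" where
  "weight (Point a) x = (if x [] then a else 0)"
| "weight (Split l r) x = weight l (\<lambda>s. x (False # s)) + weight r (\<lambda>s. x (True # s))"

fun deficit :: "cube \<Rightarrow> int" where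
  "deficit (Point a) = (if a < 0 then a else 0)"
| "deficit (Split l r) = deficit l + deficit r"

text \<open>The predicate \<open>x\<close> selects the entries that count. The bound is uniform in
  \<open>x\<close>, so one number settles all families \<open>G\<close> that reach the same
  leaf.\<close>

lemma deficit_le_weight: "deficit c \<le> weight c x"
proof (induction c arbitrary: x)
  case (Split l r)
  then show ?case by (simp add: add_mono)
qed simp

text \<open>The accumulator \<open>a\<close> is the signed weight of the coordinates already passed;
  started at 0, it leaves the share of each subset at the end of its path.\<close>

fun shares :: "int list \<Rightarrow> int \<Rightarrow> cube" where
  "shares [] a = Point a"
| "shares (w # ws) a = Split (shares ws (a - w)) (shares ws (a + w))"

definition share :: "int list \<Rightarrow> bool list \<Rightarrow> int" where
  "share ws s = (\<Sum>(w, b)\<leftarrow>zip ws s. if b then w else - w)"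

lemma full_shares: "full (length ws) (shares ws a)"
  by (induction ws arbitrary: a) auto

lemma finite_lists_len: "finite {s :: bool list. length s = n \<and> x s}"
  by (rule finite_subset[OF _ finite_lists_length_eq[of UNIV n]]) auto

lemma weight_shares:
  "weight (shares ws a) x = (\<Sum>s | length s = length ws \<and> x s. a + share ws s)"
proof (induction ws arbitrary: a x)
  case Nil
  have "{s. s = [] \<and> x s} = (if x [] then {[]} else {})" by auto
  then show ?case by (simp add: share_def)
next
  case (Cons w ws)
  let ?S = "\<lambda>b. {s. length s = length ws \<and> x (b # s)}"
  have eq: "{s. length s = length (w # ws) \<and> x s} = Cons False ` ?S False \<union> Cons True ` ?S True"
    (is "?L = ?A \<union> ?B")
  proof (intro set_eqI iffI)
    fix s assume "s \<in> ?L"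
    then show "s \<in> ?A \<union> ?B" by (cases s; cases "hd s") auto
  qed auto
  have "(\<Sum>s\<in>?A \<union> ?B. a + share (w # ws) s) = (\<Sum>s\<in>?A. a + share (w # ws) s) + (\<Sum>s\<in>?B. a + share (w # ws) s)"
    by (rule sum.union_disjoint) (auto intro: finite_lists_len)
  also have "\<dots> = (\<Sum>s\<in>?S False. a - w + share ws s) + (\<Sum>s\<in>?S True. a + w + share ws s)"
    by (simp add: sum.reindex share_def algebra_simps)
  finally show ?case unfolding eq using Cons.IH by simp
qed

section \<open>Transfers between entries along inclusions\<close>

fun lookup :: "cube \<Rightarrow> bool list \<Rightarrow> int" where
  "lookup (Split l r) (b # s) = lookup (if b then r else l) s"
| "lookup (Point a) _ = a"
| "lookup _ [] = 0"

fun add :: "int \<Rightarrow> bool list \<Rightarrow> cube \<Rightarrow> cube" where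
  "add k (b # s) (Split l r) = (if b then Split l (add k s r) else Split (add k s l) r)"
| "add k [] (Point a) = Point (a + k)"
| "add _ _ c = c"

lemma full_add [simp]: "full n c \<Longrightarrow> full n (add k s c)"
  by (induction k s c arbitrary: n rule: add.induct) auto

lemma weight_add:
  "full n c \<Longrightarrow> length s = n \<Longrightarrow> weight (add k s c) x = weight c x + (if x s then k else 0)"
  by (induction k s c arbitrary: n x rule: add.induct) auto

text \<open>
  \<open>flow g c d\<close> pays for deficits of \<open>c\<close> at \<open>s\<close> from surpluses of \<open>d\<close> at \<open>join g s\<close>. If \<open>x s\<close> implies
  \<open>y (join g s)\<close>, a deficit counts only when the surplus paying for it does, so the weight cannot grow.
\<close>

fun flow :: "bool list \<Rightarrow> cube \<Rightarrow> cube \<Rightarrow> cube \<times> cube" where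
  "flow [] (Point a) (Point b) =
    (if a < 0 \<and> 0 < b then
       if 0 \<le> a + b then (Point 0, Point (a + b)) else (Point (a + b), Point 0)
     else (Point a, Point b))"
| "flow (False # g) (Split l r) (Split l' r') =
    (case flow g l l' of (l1, l1') \<Rightarrow> case flow g r r' of (r1, r1') \<Rightarrow> (Split l1 r1, Split l1' r1'))"
| "flow (True # g) (Split l r) (Split l' r') =
    (case flow g r r' of (r1, r1') \<Rightarrow> case flow g l r1' of (l1, r2') \<Rightarrow> (Split l1 r1, Split l' r2'))"
| "flow _ c d = (c, d)"

text \<open>The flow of a cube into itself. If the leading point lies in \<open>g\<close>, all
  targets are in the right half, which settles its own deficits before its remaining surplus serves
  the left half.\<close>

fun push :: "bool list \<Rightarrow> cube \<Rightarrow> cube" where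
  "push (False # g) (Split l r) = Split (push g l) (push g r)"
| "push (True # g) (Split l r) = (case flow g l (push g r) of (l', r') \<Rightarrow> Split l' r')"
| "push _ c = c"

lemma full_flow:
  "flow g c d = (c', d') \<Longrightarrow> full n c \<Longrightarrow> full n d \<Longrightarrow> full n c' \<and> full n d'"
  by (induction g c d arbitrary: n c' d' rule: flow.induct)
    (fastforce split: prod.splits if_splits)+

lemma full_push [simp]: "full n c \<Longrightarrow> full n (push g c)"
  by (induction g c arbitrary: n rule: push.induct)
    (fastforce split: prod.splits dest: full_flow)+

text \<open>Two predicates are needed because source and target become different subcubes in the
  recursion and see the selection through different prefixes.\<close>

lemma weight_flow:
  "flow g c d = (c', d') \<Longrightarrow> (\<And>s. length s = length g \<Longrightarrow> x s \<Longrightarrow> y (join g s))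
    \<Longrightarrow> weight c' x + weight d' y \<le> weight c x + weight d y"
proof (induction g c d arbitrary: c' d' x y rule: flow.induct)
  case (1 a b)
  then show ?case by (auto split: if_splits)
next
  case (2 g l r l' r')
  obtain l1 l1' r1 r1' where f: "flow g l l' = (l1, l1')" "flow g r r' = (r1, r1')"
    by fastforce
  have x: "x (a # s) \<Longrightarrow> y (a # join g s)" if "length s = length g" for a s
    using 2(4)[of "a # s"] that by simp
  have "weight l1 (\<lambda>s. x (False # s)) + weight l1' (\<lambda>s. y (False # s))
      \<le> weight l (\<lambda>s. x (False # s)) + weight l' (\<lambda>s. y (False # s))"
    by (rule 2(1)[OF f(1)]) (auto intro: x)
  moreover have "weight r1 (\<lambda>s. x (True # s)) + weight r1' (\<lambda>s. y (True # s))
      \<le> weight r (\<lambda>s. x (True # s)) + weight r' (\<lambda>s. y (True # s))"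
    by (rule 2(2)[OF f(1)[symmetric] f(2)]) (auto intro: x)
  ultimately show ?case using 2(3) f by auto
next
  case (3 g l r l' r')
  obtain r1 r1' l1 r2' where f: "flow g r r' = (r1, r1')" "flow g l r1' = (l1, r2')"
    by fastforce
  have x: "x (a # s) \<Longrightarrow> y (True # join g s)" if "length s = length g" for a s
    using 3(4)[of "a # s"] that by simp
  have "weight r1 (\<lambda>s. x (True # s)) + weight r1' (\<lambda>s. y (True # s))
      \<le> weight r (\<lambda>s. x (True # s)) + weight r' (\<lambda>s. y (True # s))"
    by (rule 3(1)[OF f(1)]) (auto intro: x)
  \<comment> \<open>The second flow draws on \<open>r1'\<close>, the surplus left by the previous
    one, whose weight cancels when the two inequalities are added.\<close>
  moreover have "weight l1 (\<lambda>s. x (False # s)) + weight r2' (\<lambda>s. y (True # s))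
      \<le> weight l (\<lambda>s. x (False # s)) + weight r1' (\<lambda>s. y (True # s))"
    by (rule 3(2)[OF f(1)[symmetric] f(2)]) (auto intro: x)
  ultimately show ?case using 3(3) f by auto
qed auto

lemma weight_push:
  "(\<And>s. length s = length g \<Longrightarrow> x s \<Longrightarrow> x (join g s)) \<Longrightarrow> weight (push g c) x \<le> weight c x"
proof (induction g c arbitrary: x rule: push.induct)
  case (1 g l r)
  have x: "x (a # s) \<Longrightarrow> x (a # join g s)" if "length s = length g" for a s
    using 1(3)[of "a # s"] that by simp
  show ?case by (auto intro!: add_mono 1 intro: x)
next
  case (2 g l r)
  obtain l' r' where f: "flow g l (push g r) = (l', r')" by fastforce
  have x: "x (a # s) \<Longrightarrow> x (True # join g s)" if "length s = length g" for a s
    using 2(2)[of "a # s"] that by simp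
  have "weight (push g r) (\<lambda>s. x (True # s)) \<le> weight r (\<lambda>s. x (True # s))"
    by (rule 2(1)) (auto intro: x)
  moreover have "weight l' (\<lambda>s. x (False # s)) + weight r' (\<lambda>s. x (True # s))
      \<le> weight l (\<lambda>s. x (False # s)) + weight (push g r) (\<lambda>s. x (True # s))"
    by (rule weight_flow[OF f]) (auto intro: x)
  ultimately show ?case by (simp add: f)
qed auto

text \<open>Lets a certificate direct one surplus that the greedy order of \<open>push\<close> would
  spend elsewhere. The amount \<open>k\<close> is the largest that creates neither a surplus at
  \<open>s\<close> nor a deficit at \<open>t\<close>. If \<open>g\<close> lies inside
  \<open>s\<close>, both entries coincide and the guard fails.\<close>

definition move :: "bool list \<Rightarrow> bool list \<Rightarrow> cube \<Rightarrow> cube" where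
  "move s g c = (let t = join g s; a = lookup c s; b = lookup c t in
     if a < 0 \<and> 0 < b then let k = min (- a) b in add k s (add (- k) t c) else c)"

lemma full_move [simp]: "full n c \<Longrightarrow> full n (move s g c)"
  by (simp add: move_def Let_def)

lemma weight_move:
  assumes "full n c" "length s = n" "length g = n" "x s \<Longrightarrow> x (join g s)"
  shows "weight (move s g c) x \<le> weight c x"
proof -
  have "weight (add k s (add (- k) (join g s) c)) x \<le> weight c x" if "0 \<le> k" for k
    using assms that by (auto simp: weight_add[where n = n])
  then show ?thesis by (simp add: move_def Let_def)
qed

text \<open>
  The entry at a set known to be absent is arbitrary, so it is raised by a large constant and can
  then absorb the deficits of all sets forced to be absent with it. Dually, at a set known to be
  present the constant is subtracted and added to the credit, so a surplus there pays this debt.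
\<close>

definition big :: int where "big = 1000"

text \<open>The entries concerned are the solutions \<open>t\<close> of \<open>join h t = s\<close>:
  free on the points of \<open>h\<close>, equal to \<open>s\<close> elsewhere. There is none if
  \<open>h\<close> has a point outside \<open>s\<close>, a case that falls under the last
  equation.\<close>

fun raise :: "bool list \<Rightarrow> bool list \<Rightarrow> cube \<Rightarrow> cube" where
  "raise (True # h) (True # s) (Split l r) = Split (raise h s l) (raise h s r)"
| "raise (False # h) (True # s) (Split l r) = Split l (raise h s r)"
| "raise (False # h) (False # s) (Split l r) = Split (raise h s l) r"
| "raise [] [] (Point a) = Point (a + big)"
| "raise _ _ c = c"

lemma full_raise [simp]: "full n c \<Longrightarrow> full n (raise h s c)"
  by (induction h s c arbitrary: n rule: raise.induct) auto

lemma weight_raise: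
  "(\<And>t. join h t = s \<Longrightarrow> length t = length h \<Longrightarrow> \<not> x t) \<Longrightarrow> weight (raise h s c) x = weight c x"
proof (induction h s c arbitrary: x rule: raise.induct)
  case (1 h s l r)
  have "\<not> x (b # t)" if "join h t = s" "length t = length h" for b t
    using 1(3)[of "b # t"] that by simp
  then show ?case using 1(1,2) by simp
next
  case (2 h s l r)
  have "\<not> x (True # t)" if "join h t = s" "length t = length h" for t
    using 2(2)[of "True # t"] that by simp
  then show ?case using 2(1) by simp
next
  case (3 h s l r)
  have "\<not> x (False # t)" if "join h t = s" "length t = length h" for t
    using 3(2)[of "False # t"] that by simp
  then show ?case using 3(1) by simp
qed auto

text \<open>The largest union of generators inside \<open>s\<close>. A set \<open>t\<close> that
  reaches \<open>s\<close> by joining with some generators also reaches it by joining with this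
  union, so a single call of \<open>raise\<close> finds all sets that are absent because
  \<open>s\<close> is.\<close>

definition hull :: "bool list list \<Rightarrow> bool list \<Rightarrow> bool list" where
  "hull gens s = foldr join (filter (\<lambda>g. join g s = s) gens) (replicate (length s) False)"

definition stable :: "nat \<Rightarrow> bool list list \<Rightarrow> bool list set \<Rightarrow> bool" where
  "stable n gens G \<longleftrightarrow> (\<forall>g\<in>set gens. length g = n \<and> (\<forall>s\<in>G. join g s \<in> G))"

lemma stable_foldr:
  assumes "stable n gens G" "\<And>s. s \<in> G \<Longrightarrow> length s = n" "s \<in> G" "set gs \<subseteq> set gens"
  shows "length (foldr join gs (replicate n False)) = n"
    and "join (foldr join gs (replicate n False)) s \<in> G"
  using assms by (induction gs) (auto simp: stable_def join_assoc)

lemma weight_raise_hull: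
  assumes G: "\<And>s. s \<in> G \<Longrightarrow> length s = n" and st: "stable n gens G" and s: "length s = n" "s \<notin> G"
  shows "weight (raise (hull gens s) s c) (\<lambda>s. s \<in> G) = weight c (\<lambda>s. s \<in> G)"
proof (rule weight_raise)
  fix t assume "join (hull gens s) t = s"
  then show "t \<notin> G"
    using stable_foldr(2)[OF st G, of t "filter (\<lambda>g. join g s = s) gens"] s by (auto simp: hull_def)
qed

section \<open>Elementary transfer steps and their soundness\<close>

datatype step = Push "nat list" | Move "nat list" "nat list"

definition bits :: "nat \<Rightarrow> nat list \<Rightarrow> bool list" where
  "bits n e = map (\<lambda>i. i \<in> set e) [0..<n]"

lemma length_bits [simp]: "length (bits n e) = n"
  by (simp add: bits_def)

fun allowed :: "nat \<Rightarrow> bool list list \<Rightarrow> step \<Rightarrow> bool" where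
  "allowed n gens (Push g) \<longleftrightarrow> bits n g \<in> set gens"
| "allowed n gens (Move s g) \<longleftrightarrow> bits n g \<in> set gens"

fun apply_step :: "nat \<Rightarrow> cube \<Rightarrow> step \<Rightarrow> cube" where
  "apply_step n c (Push g) = push (bits n g) c"
| "apply_step n c (Move s g) = move (bits n s) (bits n g) c"

lemma apply_step:
  assumes "stable n gens G" "allowed n gens st" "full n c" "\<And>s. s \<in> G \<Longrightarrow> length s = n"
  shows "full n (apply_step n c st)" "weight (apply_step n c st) (\<lambda>s. s \<in> G) \<le> weight c (\<lambda>s. s \<in> G)"
  using assms by (cases st; auto intro!: weight_push weight_move simp: stable_def)+

lemma apply_steps:
  assumes "stable n gens G" "\<And>s. s \<in> G \<Longrightarrow> length s = n"
  shows "list_all (allowed n gens) sts \<Longrightarrow> full n c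
    \<Longrightarrow> weight (foldl (apply_step n) c sts) (\<lambda>s. s \<in> G) \<le> weight c (\<lambda>s. s \<in> G)"
proof (induction sts arbitrary: c)
  case (Cons st sts)
  show ?case
    using Cons.IH[of "apply_step n c st"] Cons.prems apply_step[OF assms(1), of st c] assms(2)
    by fastforce
qed simp

text \<open>A node of the branching as the checker sees it. The lists in \<open>gens\<close> are
  sets with which members of \<open>G\<close> may be joined; they need not be members themselves, as
  the unions of the given triples show.\<close>

datatype state = State (gens: "bool list list") (absent: "bool list list") (credit: int) (cube: cube)

definition forget :: "bool list \<Rightarrow> state \<Rightarrow> state" where
  "forget s S = State (gens S) (s # absent S) (credit S) (raise (hull (gens S) s) s (cube S))"

text \<open>More generators give larger hulls, so an absent set may now exclude further sets; for
  this reason all absent sets are raised again. An entry raised repeatedly does no harm, as it never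
  counts.\<close>

definition extend :: "bool list list \<Rightarrow> state \<Rightarrow> state" where
  "extend new S = State (gens S @ new) (absent S) (credit S + big * int (length new))
     (fold (\<lambda>t. raise (hull (gens S @ new) t) t) (absent S) (fold (add (- big)) new (cube S)))"

text \<open>If \<open>gens\<close> is closed under union, so is the new list, and a chain of joins
  is always a single join. The filter keeps a set from being listed or debited twice.\<close>

definition adjoin :: "bool list \<Rightarrow> state \<Rightarrow> state" where
  "adjoin s S = extend (filter (\<lambda>t. t \<notin> set (gens S)) (remdups (s # map (join s) (gens S)))) S"

text \<open>In the application \<open>v\<close> is the total share of \<open>G\<close>; the
  invariant says that the bookkeeping never overstates it.\<close>

definition valid :: "nat \<Rightarrow> bool list set \<Rightarrow> int \<Rightarrow> state \<Rightarrow> bool" where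
  "valid n G v S \<longleftrightarrow> stable n (gens S) G \<and> (\<forall>s\<in>set (absent S). length s = n \<and> s \<notin> G)
     \<and> full n (cube S) \<and> credit S + weight (cube S) (\<lambda>s. s \<in> G) \<le> v"

text \<open>\<open>G\<close> stands for the parts inside \<open>U\<close>, coded as characteristic
  lists, of those members of \<open>F\<close> that have a given part outside
  \<open>U\<close>.\<close>

locale trace =
  fixes n :: nat and G :: "bool list set"
  assumes length: "s \<in> G \<Longrightarrow> length s = n"
    and join: "s \<in> G \<Longrightarrow> t \<in> G \<Longrightarrow> join s t \<in> G"
begin

lemma valid_forget:
  assumes "valid n G v S" "length s = n" "s \<notin> G"
  shows "valid n G v (forget s S)"
  using assms length by (auto simp: valid_def forget_def weight_raise_hull)

lemma add_fold:
  assumes "full n c" "\<And>s. s \<in> set new \<Longrightarrow> s \<in> G"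
  shows "full n (fold (add (- big)) new c)
    \<and> weight (fold (add (- big)) new c) (\<lambda>s. s \<in> G) = weight c (\<lambda>s. s \<in> G) - big * int (length new)"
  using assms
  by (induction new arbitrary: c) (auto simp: weight_add length algebra_simps)

lemma raise_fold:
  assumes "full n c" "stable n gs G" "\<And>s. s \<in> set ab \<Longrightarrow> length s = n \<and> s \<notin> G"
  shows "full n (fold (\<lambda>t. raise (hull gs t) t) ab c)
    \<and> weight (fold (\<lambda>t. raise (hull gs t) t) ab c) (\<lambda>s. s \<in> G) = weight c (\<lambda>s. s \<in> G)"
  using assms
  by (induction ab arbitrary: c) (auto simp: weight_raise_hull length)

lemma valid_extend:
  assumes S: "valid n G v S" and new: "\<And>t. t \<in> set new \<Longrightarrow> t \<in> G"
  shows "valid n G v (extend new S)"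
proof -
  have st: "stable n (gens S @ new) G"
    using S new length join by (auto simp: valid_def stable_def)
  have "full n (cube S)" using S by (simp add: valid_def)
  note a = add_fold[OF this new]
  have "length t = n \<and> t \<notin> G" if "t \<in> set (absent S)" for t
    using that S by (simp add: valid_def)
  note b = raise_fold[OF conjunct1[OF a] st this]
  show ?thesis
    using S st a b by (simp add: extend_def valid_def)
qed

lemma valid_adjoin:
  assumes S: "valid n G v S" and s: "s \<in> G"
  shows "valid n G v (adjoin s S)"
  unfolding adjoin_def
proof (rule valid_extend[OF S])
  fix t assume "t \<in> set (filter (\<lambda>t. t \<notin> set (gens S)) (remdups (s # map (join s) (gens S))))"
  then have "t = s \<or> (\<exists>g\<in>set (gens S). t = join g s)"
    unfolding set_filter set_remdups list.set set_map by (auto simp: join_commute[of s])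
  then show "t \<in> G" using S s by (auto simp: valid_def stable_def)
qed

end

text \<open>In \<open>Branch s a b\<close> the certificate \<open>a\<close> treats \<open>s \<notin> G\<close> and \<open>b\<close> treats \<open>s \<in> G\<close>.\<close>

datatype cert = Leaf "step list" | Branch "nat list" cert cert

fun check :: "nat \<Rightarrow> cert \<Rightarrow> state \<Rightarrow> bool" where
  "check n (Leaf sts) S \<longleftrightarrow> list_all (allowed n (gens S)) sts
     \<and> 0 \<le> credit S + deficit (foldl (apply_step n) (cube S) sts)"
| "check n (Branch s a b) S \<longleftrightarrow> check n a (forget (bits n s) S) \<and> check n b (adjoin (bits n s) S)"

text \<open>At every \<open>Branch\<close> the actual \<open>G\<close> decides which certificate is
  followed. Exactly one leaf is reached, and its bound applies to \<open>G\<close>.\<close>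

lemma (in trace) check_sound:
  "valid n G v S \<Longrightarrow> check n C S \<Longrightarrow> 0 \<le> v"
proof (induction C arbitrary: S)
  case (Leaf sts)
  then have "weight (foldl (apply_step n) (cube S) sts) (\<lambda>s. s \<in> G) \<le> weight (cube S) (\<lambda>s. s \<in> G)"
    by (intro apply_steps[of n "gens S"]) (auto simp: valid_def length)
  with Leaf deficit_le_weight[of "foldl (apply_step n) (cube S) sts" "\<lambda>s. s \<in> G"] show ?case
    by (simp add: valid_def)
next
  case (Branch s a b)
  then show ?case
    using valid_forget[of v S "bits n s"] valid_adjoin[of v S "bits n s"]
    by (cases "bits n s \<in> G") simp_all
qed

subsection \<open>From certificates to FC-families\<close>

text \<open>All nonempty unions, computed in advance so that the initial generators are closed under
  union.\<close>

fun unions :: "bool list list \<Rightarrow> bool list list" where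
  "unions [] = []"
| "unions (g # gs) = (let us = unions gs in remdups (g # map (join g) us @ us))"

text \<open>Besides the certificate it checks what the averaging relies on: positive weights, at
  least one point, and every point covered by \<open>E\<close>, so that the points are exactly those
  of \<open>U\<close>.\<close>

definition verify :: "nat list list \<Rightarrow> int list \<Rightarrow> cert \<Rightarrow> bool" where
  "verify E ws C \<longleftrightarrow> (let n = length ws in
     list_all (\<lambda>w. 0 < w) ws \<and> ws \<noteq> [] \<and>
     list_all (\<lambda>i. list_ex (\<lambda>e. i \<in> set e) E) [0..<n] \<and>
     check n C (adjoin (replicate n True) (State (unions (map (bits n) E)) [] 0 (shares ws 0))))"

lemma stable_unions:
  assumes "stable n gs G"
  shows "stable n (unions gs) G"
  using assms by (induction gs) (auto simp: stable_def Let_def join_assoc)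

lemma (in trace) share_nonneg:
  assumes v: "verify E ws C" and n: "length ws = n" and full: "replicate n True \<in> G"
    and E: "\<And>e s. e \<in> set E \<Longrightarrow> s \<in> G \<Longrightarrow> join (bits n e) s \<in> G"
  shows "0 \<le> (\<Sum>s\<in>G. share ws s)"
proof (rule check_sound)
  have "stable n (map (bits n) E) G"
    using E by (auto simp: stable_def)
  moreover have "{s. length s = n \<and> s \<in> G} = G" using length by auto
  ultimately show "valid n G (\<Sum>s\<in>G. share ws s)
      (adjoin (replicate n True) (State (unions (map (bits n) E)) [] 0 (shares ws 0)))"
    using full n full_shares[of ws 0]
    by (intro valid_adjoin) (simp_all add: valid_def stable_unions weight_shares)
  show "check n C (adjoin (replicate n True) (State (unions (map (bits n) E)) [] 0 (shares ws 0)))"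
    using v n by (simp add: verify_def Let_def)
qed

lemma share_sum:
  "length us = length ws \<Longrightarrow> share ws (map (\<lambda>u. u \<in> A) us) = (\<Sum>i<length ws. if us ! i \<in> A then ws ! i else - ws ! i)"
  by (simp add: share_def sum_list_sum_nth atLeast0LessThan)

text \<open>\<open>E\<close> and \<open>ws\<close> speak about positions, so
  \<open>verify E ws C\<close> is a closed term that is evaluated once; the list \<open>us\<close>
  carries the result over to arbitrary distinct points of any type.\<close>

lemma fc_family_if_verify:
  assumes v: "verify E ws C" and us: "distinct us" "length us = length ws"
    and E: "\<forall>e\<in>set E. \<forall>i\<in>set e. i < length ws"
  shows "fc_family ((\<lambda>e. (!) us ` set e) ` set E)"
  unfolding fc_family_def
proof (intro allI impI, elim conjE, rule ccontr)
  fix F :: "'a set set"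
  assume F: "finite F" "union_closed F" and sub: "(\<lambda>e. (!) us ` set e) ` set E \<subseteq> F"
    and nf: "\<not> frankl F"
  define n where "n = length ws"
  define edge where "edge = (\<lambda>e. (!) us ` set e)"
  define U where "U = set us"
  define code where "code = (\<lambda>A. map (\<lambda>u. u \<in> A) us)"
  define h where "h = (\<lambda>A::'a set. A - U)"
  have len: "length us = n" using us by (simp add: n_def)
  have F_union: "A \<union> B \<in> F" if "A \<in> F" "B \<in> F" for A B
    using F that by (auto simp: union_closed_def)
  have cover: "\<exists>e\<in>set E. i \<in> set e" if "i < n" for i
    using v that by (auto simp: verify_def Let_def list_all_iff list_ex_iff n_def)
  have U: "U = \<Union> (edge ` set E)"
    using cover E len by (fastforce simp: U_def edge_def n_def set_conv_nth)
  have code_Un: "code (A \<union> B) = join (code A) (code B)" for A B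
    unfolding code_def by (induction us) auto
  have code_edge: "code (edge e) = bits n e" if "e \<in> set E" for e
  proof (rule nth_equalityI)
    fix i assume "i < length (code (edge e))"
    then have i: "i < n" by (simp add: code_def len)
    have "us ! i \<in> edge e \<longleftrightarrow> i \<in> set e"
      using i that E us len by (auto simp: edge_def n_def nth_eq_iff_index_eq)
    then show "code (edge e) ! i = bits n e ! i" using i by (simp add: code_def bits_def len)
  qed (simp add: code_def len)
  have code_inj: "A = B" if "code A = code B" "h A = h B" for A B
    using that by (auto simp: code_def h_def U_def)
  \<comment> \<open>One trace for each part \<open>k\<close> outside \<open>U\<close>. Uniting two
    members with the same outside part, or adding a set \<open>edge e \<subseteq> U\<close>, leaves
    that part unchanged.\<close>
  have nonneg: "0 \<le> (\<Sum>A | A \<in> F \<and> h A = k. share ws (code A))" if "k \<in> h ` F" for k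
  proof -
    let ?S = "{A \<in> F. h A = k}"
    have inj: "inj_on code ?S" by (rule inj_onI, rule code_inj) auto
    interpret trace n "code ` ?S"
    proof
      show "length s = n" if "s \<in> code ` ?S" for s using that by (auto simp: code_def len)
      show "join s t \<in> code ` ?S" if st: "s \<in> code ` ?S" "t \<in> code ` ?S" for s t
      proof -
        obtain A B where "A \<in> ?S" "B \<in> ?S" "s = code A" "t = code B" using st by auto
        then show ?thesis
          using F_union[of A B] by (intro image_eqI[of _ _ "A \<union> B"]) (auto simp: code_Un h_def)
      qed
    qed
    have union: "edge e \<union> A \<in> ?S" if "e \<in> set E" "A \<in> ?S" for e A
    proof -
      have "edge e \<in> F" using sub that by (auto simp: edge_def)
      then show ?thesis using that F_union U by (auto simp: h_def)
    qed
    \<comment> \<open>\<open>F\<close> is closed under binary unions, so \<open>U\<close> is reached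
      by adding the sets \<open>edge e\<close> one at a time.\<close>
    have "A \<union> \<Union> (edge ` set E') \<in> ?S" if "A \<in> ?S" "set E' \<subseteq> set E" for A E'
      using that(2)
    proof (induction E')
      case Nil
      then show ?case using that by simp
    next
      case (Cons e E')
      then have "edge e \<union> (A \<union> \<Union> (edge ` set E')) \<in> ?S" by (intro union) auto
      then show ?case by (simp add: Un_left_commute)
    qed
    moreover obtain A where "A \<in> ?S" using \<open>k \<in> h ` F\<close> by auto
    ultimately have "A \<union> U \<in> ?S" unfolding U by blast
    moreover have "code (A \<union> U) = replicate n True"
      by (rule nth_equalityI) (auto simp: code_def len U_def)
    ultimately have full: "replicate n True \<in> code ` ?S" by (metis image_eqI)
    have "0 \<le> (\<Sum>s\<in>code ` ?S. share ws s)"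
    proof (rule share_nonneg[OF v _ full])
      fix e s assume e: "e \<in> set E" and "s \<in> code ` ?S"
      then obtain A where "A \<in> ?S" "s = code A" by auto
      then show "join (bits n e) s \<in> code ` ?S"
        using union[OF e] by (intro image_eqI[of _ _ "edge e \<union> A"]) (auto simp: code_Un code_edge e)
    qed (simp add: n_def)
    then show ?thesis using inj by (simp add: sum.reindex)
  qed
  \<comment> \<open>The total share of \<open>F\<close> is computed in two ways: by outside parts,
    where it is nonnegative, and by points, where a failure of the Frankl condition makes it
    negative.\<close>
  have "0 \<le> (\<Sum>k\<in>h ` F. \<Sum>A | A \<in> F \<and> h A = k. share ws (code A))"
    by (rule sum_nonneg) (rule nonneg)
  also have "\<dots> = (\<Sum>A\<in>F. share ws (code A))"
    using F by (intro sum.image_gen[symmetric])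
  also have "\<dots> = (\<Sum>A\<in>F. \<Sum>i<n. if us ! i \<in> A then ws ! i else - ws ! i)"
    using us by (simp add: code_def share_sum n_def)
  also have "\<dots> = (\<Sum>i<n. \<Sum>A\<in>F. if us ! i \<in> A then ws ! i else - ws ! i)"
    by (rule sum.swap)
  also have "\<dots> = (\<Sum>i<n. ws ! i * (2 * int (card {A \<in> F. us ! i \<in> A}) - int (card F)))"
  proof (rule sum.cong)
    fix i
    let ?T = "{A \<in> F. us ! i \<in> A}" and ?N = "{A \<in> F. us ! i \<notin> A}"
    have "card F = card ?T + card ?N"
      using F by (subst card_Un_disjoint[symmetric]) (auto intro: arg_cong[of _ _ card])
    moreover have "(\<Sum>A\<in>F. if us ! i \<in> A then ws ! i else - ws ! i)
        = ws ! i * int (card ?T) - ws ! i * int (card ?N)"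
      using F by (simp add: sum.If_cases Int_def conj_commute)
    ultimately show "(\<Sum>A\<in>F. if us ! i \<in> A then ws ! i else - ws ! i)
        = ws ! i * (2 * int (card ?T) - int (card F))"
      by (simp add: algebra_simps)
  qed simp
  also have "\<dots> < 0"
  proof -
    \<comment> \<open>Each point of \<open>U\<close> lies in a member of \<open>F\<close> and is
      therefore a candidate in the Frankl condition; its failure there is strict, and strictness
      survives the positive weight.\<close>
    have neg: "ws ! i * (2 * int (card {A \<in> F. us ! i \<in> A}) - int (card F)) < 0" if i: "i < n" for i
    proof -
      have "us ! i \<in> U" using i len by (auto simp: U_def)
      then have "us ! i \<in> \<Union> F" using U sub by (auto simp: edge_def)
      then have "2 * card {A \<in> F. us ! i \<in> A} < card F"
        using nf by (auto simp: frankl_def not_le)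
      moreover have "0 < ws ! i"
        using v i by (auto simp: verify_def Let_def list_all_length n_def)
      ultimately show ?thesis by (intro mult_pos_neg) auto
    qed
    have "0 < n" using v by (auto simp: verify_def Let_def n_def)
    then have "(\<Sum>i<n. ws ! i * (2 * int (card {A \<in> F. us ! i \<in> A}) - int (card F))) < (\<Sum>i<n. 0)"
      by (intro sum_strict_mono neg) auto
    then show ?thesis by simp
  qed
  finally show False by simp
qed

text \<open>The entries are -1 at the empty set and 1 at \<open>{a}\<close>, and joining with
  \<open>{a}\<close> lets the second pay for the first. Evaluation with \<open>code_simp\<close> is
  rewriting, so the run of the checker is itself checked by the kernel.\<close>

lemma fc_family_singleton: "fc_family {{a}}"
proof -
  have "verify [[0]] [1] (Leaf [Push [0]])" by code_simp
  from fc_family_if_verify[OF this, of "[a]"] show ?thesis by simp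
qed

text \<open>The entries are -2, 0, 0, 2, and the pair pays for the empty set.\<close>

lemma fc_family_pair:
  assumes "a \<noteq> b"
  shows "fc_family {{a, b}}"
proof -
  have "verify [[0, 1]] [1, 1] (Leaf [Push [0, 1]])" by code_simp
  from fc_family_if_verify[OF this, of "[a, b]"] assms show ?thesis by simp
qed

subsection \<open>Certificates\<close>

text \<open>
  The digits in the lemma names are positions in the list of points. Weights and certificates were
  found by a branch-and-bound search with maximum flows as bounds.
\<close>

lemma fc_012_013_014:
  assumes "distinct [a, b, c, d, e]"
  shows "fc_family {{a, b, c}, {a, b, d}, {a, b, e}}"
proof -
  \<comment> \<open>The two points common to all triples get the larger weight.\<close>
  have "verify [[0, 1, 2], [0, 1, 3], [0, 1, 4]] [3, 3, 2, 2, 2]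
    (Branch [4] (Branch [2] (Branch [3] (Leaf [Push [0,1,4], Push [0,1,2,3], Push [0,1,2,3,4],
    Push [0,1,3], Push [0,1,2]]) (Leaf [Push [3], Push [0,1,4], Push [0,1,2], Push [0,1,2,4],
    Push [0,1,3]])) (Branch [0,2] (Leaf [Push [2], Push [0,1,4], Push [0,1,3], Push [0,1,3,4],
    Push [0,1,2]]) (Branch [3] (Leaf [Push [0,1,3,4], Push [0,2], Push [0,1,4], Push [0,1,3]])
    (Leaf [Push [3], Push [0,2], Push [0,1,4], Push [0,1,3], Push [0,2,3]])))) (Branch [2,3]
    (Branch [3] (Branch [2,4] (Leaf [Push [0,1,2], Push [0,1,3], Push [0,1,2,3], Push [0,1,4]])
    (Branch [3,4] (Leaf [Push [4], Push [0,1,3], Push [0,1,4], Push [0,1,2]]) (Leaf [Push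
    [2,3,4], Push [2,4], Push [0,1,3], Push [0,1,2]]))) (Branch [0] (Leaf [Push [4], Push
    [0,1,2], Push [0,1,4], Push [0,1,3]]) (Leaf [Push [4], Push [0,1,2], Push [0,1,4], Push
    [0,3]]))) (Leaf [Push [4], Push [2,3,4], Push [2,3], Push [0,1,4], Push [0,1,3], Push
    [0,1,2]])))"
    by code_simp
  from fc_family_if_verify[OF this, of "[a, b, c, d, e]"] assms show ?thesis by simp
qed

text \<open>Removing the common point \<open>a\<close> leaves the edges of a triangle; in
  \<open>fc_012_013_014\<close> they form a star and in \<open>fc_012_013_024\<close> a path. These
  are all graphs with three edges on at most four vertices, which accounts for the families with a
  common point.\<close>

lemma fc_012_013_023:
  assumes "distinct [a, b, c, d]"
  shows "fc_family {{a, b, c}, {a, b, d}, {a, c, d}}"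
proof -
  have "verify [[0, 1, 2], [0, 1, 3], [0, 2, 3]] [1, 1, 1, 1]
    (Branch [3] (Leaf [Push [0,2,3], Push [0,1,3], Push [0,1,2]]) (Branch [2] (Leaf [Push
    [0,1,2], Push [0,2,3], Push [0,1,3]]) (Leaf [Push [2,3], Push [0,1,2], Push [0,1,3]])))"
    by code_simp
  from fc_family_if_verify[OF this, of "[a, b, c, d]"] assms show ?thesis by simp
qed

lemma fc_012_013_024:
  assumes "distinct [a, b, c, d, e]"
  shows "fc_family {{a, b, c}, {a, b, d}, {a, c, e}}"
proof -
  have "verify [[0, 1, 2], [0, 1, 3], [0, 2, 4]] [4, 3, 3, 2, 2]
    (Branch [0] (Branch [4] (Branch [2,4] (Leaf [Push [0,1,3], Push [0,2,4], Push [0,1,2,3,4],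
    Push [0,1,2], Push [0,1,2,4]]) (Leaf [Push [0,1,3], Push [0,1,2], Push [0,2,4], Push
    [2,4]])) (Branch [1,4] (Leaf [Push [4], Push [0,1,2], Push [0,2,4], Push [0,1,3]]) (Branch
    [2] (Leaf [Push [1,4], Push [0,2,4], Push [0,1,3], Push [0,1,2]]) (Leaf [Push [1,4], Push
    [2], Push [0,1,3], Push [0,2,4], Push [0,1,2], Push [1,2,4]])))) (Branch [1,3] (Branch [3]
    (Leaf [Push [0], Push [0,2,4], Push [0,1,3], Push [0,1,2,3,4], Push [0,1,2]]) (Leaf [Push
    [0,1,2], Push [0,1,3], Push [0,3], Push [0,2,4], Push [3]])) (Branch [4] (Leaf [Push
    [0,1,2,4], Push [0,1,2], Push [0,1,3], Push [1,3], Push [0], Push [0,2,4]]) (Leaf [Push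
    [0,1,2], Push [0], Push [0,2,4], Push [4], Push [1,3,4], Push [1,3]]))))"
    by code_simp
  from fc_family_if_verify[OF this, of "[a, b, c, d, e]"] assms show ?thesis by simp
qed

text \<open>Of the four families of three triples, the one without a common point.\<close>

lemma fc_012_013_234:
  assumes "distinct [a, b, c, d, e]"
  shows "fc_family {{a, b, c}, {a, b, d}, {c, d, e}}"
proof -
  have "verify [[0, 1, 2], [0, 1, 3], [2, 3, 4]] [2, 2, 2, 2, 1]
    (Branch [4] (Branch [3] (Leaf [Move [0,4] [0,1,2], Move [2,4] [0,1,2], Push [0,1,3], Push
    [2,3,4], Push [0,1,2,3,4], Push [0,1,2]]) (Leaf [Move [3] [0,1,2,3,4], Move [0] [2,3,4],
    Move [1] [2,3,4], Push [2,3,4], Push [3], Move [2,4] [0,1,2], Push [0,1,2], Push [0,1,3]]))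
    (Branch [2,3] (Branch [3] (Leaf [Push [4], Push [2,3,4], Push [0,1,3], Push [0,1,2], Push
    [0,1,2,3]]) (Leaf [Push [4], Push [2,3,4], Push [0,1,2], Push [0,1,3]])) (Leaf [Push [4],
    Push [2,3], Push [2,3,4], Push [0,1,3], Push [0,1,2]])))"
    by code_simp
  from fc_family_if_verify[OF this, of "[a, b, c, d, e]"] assms show ?thesis by simp
qed

section \<open>Four triples, two of which share two points\<close>

lemma fc_012_013_245_345:
  assumes "distinct [a, b, c, d, e, f]"
  shows "fc_family {{a, b, c}, {a, b, d}, {c, e, f}, {d, e, f}}"
proof -
  \<comment> \<open>Both \<open>{a, b}\<close> and \<open>{e, f}\<close> are completed by
    \<open>c\<close> and by \<open>d\<close>. Every point lies in two triples, and constant weights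
    suffice.\<close>
  have "verify [[0, 1, 2], [0, 1, 3], [2, 4, 5], [3, 4, 5]] [1, 1, 1, 1, 1, 1]
    (Branch [2,3] (Branch [2] (Branch [1,3] (Branch [1] (Leaf [Push [3,4,5], Push [0,1,3], Push
    [2,4,5], Push [0,1,2], Push [0,1,2,3], Push [2,3,4,5], Push [0,1,2,3,4,5], Push
    [0,1,2,4,5]]) (Leaf [Push [0,1,3], Push [0,1,2], Push [2,3,4,5], Push [3,4,5]])) (Leaf [Push
    [2,4,5], Push [0,1,2], Push [2,3,4,5], Push [1,3], Push [0,1,3], Push [0,1,2,3], Push
    [3,4,5]])) (Branch [1] (Leaf [Push [3,4,5], Push [0,1,3], Push [0,1,3,4,5], Push [2,4,5],
    Push [2,3,4,5], Push [0,1,2], Push [0,1,2,4,5], Push [0,1,2,3]]) (Leaf [Push [0,1,2,3], Push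
    [0,1,2], Push [3,4,5], Push [1,2], Push [0,1,3], Push [2,4,5], Push [2,3,4,5]]))) (Branch
    [0,1] (Leaf [Push [3,4,5], Push [2,3], Push [0,1,3], Push [2,4,5], Push [2,3,4,5], Push
    [0,1,2,4,5], Push [0,1,2], Push [0,1,2,3], Push [0,1,3,4,5]]) (Leaf [Push [2,3,4,5], Push
    [0,1], Push [2,3], Push [3,4,5], Push [2,4,5], Push [0,1,2,3]])))"
    by code_simp
  from fc_family_if_verify[OF this, of "[a, b, c, d, e, f]"] assms show ?thesis by simp
qed

text \<open>Without the common point \<open>a\<close> the triples are two disjoint paths of two
  edges, with centres \<open>b\<close> and \<open>e\<close>; the weights decrease from
  \<open>a\<close> over the centres to the ends.\<close>

lemma fc_012_013_045_046:
  assumes "distinct [a, b, c, d, e, f, g]"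
  shows "fc_family {{a, b, c}, {a, b, d}, {a, e, f}, {a, e, g}}"
proof -
  have "verify [[0, 1, 2], [0, 1, 3], [0, 4, 5], [0, 4, 6]] [4, 3, 2, 2, 3, 2, 2]
    (Branch [2,5] (Branch [5] (Branch [3,6] (Branch [6] (Branch [2,6] (Branch [3,5] (Branch [4]
    (Leaf [Push [0,1,2,3], Push [0,1,3], Push [0,1,2,4,5,6], Push [0,1,2], Push [0,4,5], Push
    [0,4,6], Push [0,4,5,6], Push [0,1,3,4,5,6], Push [0,1,2,4,6], Push [0,1,3,4,6], Push
    [0,1,2,4,5]]) (Leaf [Push [0,4,5,6], Push [0,1,2,3], Push [0,4,6], Push [4], Push [0,1,3],
    Push [0,1,2], Push [0,4,5]])) (Leaf [Push [3,5], Push [0,1,2], Push [0,4,6], Push [0,1,3],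
    Push [0,4,5], Push [0,3,4,5,6], Push [0,4,5,6], Push [0,3,4,5], Push [0,1,2,3,5], Push
    [0,1,3,4,6]])) (Branch [2,3,5,6] (Leaf [Push [0,1,3], Push [0,4,5], Push [0,2,4,6], Push
    [2,6], Push [0,1,2], Push [0,1,3,4,5], Push [0,2,4,5,6], Push [0,1,2,3,6], Push [0,4,5,6],
    Push [0,4,6]]) (Leaf [Push [2,3,5,6], Push [2,6], Push [0,1,3], Push [0,4,5], Push [0,4,6],
    Push [0,1,2], Push [0,1,3,4,5]]))) (Branch [3,5,6] (Branch [1,3] (Leaf [Push [6], Move [0]
    [0,1,3,4,5], Push [0,4,5,6], Push [0,1,2,3], Push [0,4,6], Push [0,1,2], Push [0,4,5], Push
    [0,1,3]]) (Leaf [Push [0,4,5,6], Push [0,1,2,3], Push [1,3,6], Push [0,4,6], Push [0,1,2],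
    Move [2] [0,1,2,4,5], Move [4] [0,1,3], Push [0,1,3], Push [0,1,3,6], Push [0,4,5]])) (Leaf
    [Push [6], Push [0,1,2], Push [3,5,6], Push [0,4,6], Push [0,4,5], Push [0,1,3], Push
    [0,1,3,4,5], Push [0,3,4,5,6]]))) (Branch [2,3,6] (Leaf [Push [0,1,3,4,5,6], Push [3,6],
    Push [0,3,4,6], Push [0,1,2,3,6], Push [0,1,2,4,5], Move [3,4] [0,1,2], Move [1,6]
    [0,4,5,6], Move [1] [0,4,6], Push [0,4,6], Push [0,4,5,6], Move [3,5] [0,1,2,3], Push
    [0,1,2,3], Push [0,1,3], Move [4] [0,1,2], Push [0,1,2], Push [0,4,5]]) (Branch [3,4,6]
    (Leaf [Push [0,1,2,4,5], Push [2,3,6], Push [0,1,3], Push [0,1,2], Push [0,4,5], Push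
    [0,4,6], Push [0,4,5,6], Push [0,1,2,4,6], Push [0,1,2,3]]) (Branch [1] (Leaf [Push [3,6],
    Push [2,3,4,6], Push [2,3,6], Push [3,4,6], Move [2] [0,1,3,4,5], Move [0] [0,1,2,4,5], Move
    [2,6] [0,4,5], Move [2,3] [0,4,5], Move [1,6] [0,4,5], Push [0,4,5,6], Push [0,4,6], Push
    [0,4,5], Push [0,1,2], Push [0,1,3], Push [0,1,2,3,6]]) (Leaf [Push [1], Push [0,1,2,4,5],
    Push [1,3,4,6], Push [2,3,6], Push [0,1,2], Push [0,1,3], Push [0,1,2,3,6], Push [0,4,5],
    Push [0,4,6]]))))) (Branch [3,5,6] (Branch [3,5] (Branch [6] (Leaf [Push [0,4,5,6], Push
    [0,1,2,3], Push [0,4,5], Push [0,1,2], Push [0,1,3,4,6], Move [1,6] [0,1,3,5], Push [0,4,6],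
    Push [0,1,3]]) (Leaf [Push [0,4,6], Push [5,6], Push [0,4,5], Push [0,1,3], Push [0,1,2]]))
    (Leaf [Push [0,4,5,6], Push [0,3,4,5], Push [0,4,5], Push [3,5], Push [0,1,2,3,5], Push
    [0,1,2,4,6], Push [0,1,3,5], Move [1] [0,4,6], Move [2,3] [0,4,6], Push [0,4,6], Push
    [0,1,3], Push [0,1,2,5], Push [0,1,2], Push [0,1,2,3]])) (Branch [4,5] (Branch [5,6] (Leaf
    [Push [0,4,6], Push [3,5,6], Push [0,4,5], Push [0,1,2,3], Push [0,1,3], Push [0,1,2,5]])
    (Leaf [Push [0,1,2,4,5], Push [5], Push [3,5,6], Push [0,3,4,5,6], Move [6] [0,1,2,3,4,6],
    Move [2,6] [0,1,3], Move [3,4] [0,1,2], Push [0,1,3], Push [5,6], Push [0,1,2,4,6], Push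
    [0,1,2], Move [2,5,6] [0,4,5], Push [0,4,5], Push [0,4,6]])) (Branch [2,3,6] (Leaf [Push
    [5], Move [3] [0,1,2,4,6], Push [0,1,3,4,6], Move [1] [0,1,2,4,6], Move [2,6] [0,3,4,5,6],
    Move [1,2] [3,4,5,6], Move [1,5] [0,4,5], Move [1,2,5] [3,5,6], Push [3,5,6], Push [0,4,6],
    Push [0,4,5], Push [4,5], Push [0,1,2], Push [0,1,3]]) (Leaf [Push [4,5], Push [0,4,5], Push
    [2,3,6], Push [0,1,2], Push [0,1,3], Push [0,4,6], Push [2,3,4,5,6], Push [3,4,5,6], Push
    [3,5,6]]))))) (Branch [2,5,6] (Branch [1] (Branch [1,3] (Leaf [Push [2,5], Push [0,4,5,6],
    Move [] [0,1,2,4,6], Move [3,6] [0,1,2,3,5], Push [0,1,2,3,5], Move [4] [0,1,2,3], Move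
    [3,5] [0,2,4,5], Move [2,3,6] [0,1,2,3], Push [0,4,6], Push [0,1,2], Push [0,1,3], Push
    [0,4,5], Push [0,1,2,5], Push [0,1,3,4,6]]) (Leaf [Push [0,4,5,6], Push [0,4,5], Push
    [0,1,2,5], Push [2,5], Push [1,3], Push [0,1,2,4,6], Push [0,1,2], Push [1,2,3,5], Push
    [0,1,2,3], Move [1,6] [0,4,6], Push [0,1,3], Push [0,4,6]])) (Leaf [Push [1], Push [0,1,3],
    Push [0,4,6], Push [2,5], Push [0,1,2,5], Push [0,1,2], Push [1,2,5], Push [0,2,4,5], Push
    [0,1,3,4,6], Push [0,2,4,5,6], Push [0,4,5]])) (Branch [2,4,5] (Branch [1] (Branch [4,6]
    (Leaf [Push [2,5], Push [0,1,2], Push [2,5,6], Push [0,2,4,5], Move [5,6] [0,1,3], Push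
    [0,1,3], Push [0,4,5,6], Push [0,4,6], Push [0,4,5], Push [0,1,3,4,6], Push [0,1,3,4,5]])
    (Leaf [Push [0,1,3], Push [4,6], Push [0,1,2], Push [0,1,2,3], Push [2,5,6], Push [2,4,5,6],
    Move [3] [0,2,4,5,6], Push [0,4,5], Push [0,4,6], Push [0,1,3,4,5]])) (Branch [3] (Leaf
    [Push [0,1,3], Push [1,2,5], Push [0,1,2], Push [0,1,3,4,6], Push [2,5,6], Push [0,4,6],
    Push [0,2,4,5], Push [0,4,5]]) (Leaf [Push [1], Push [0,1,2], Push [0,1,3], Push [0,4,6],
    Push [1,2,3,5], Push [2,3,5,6], Push [2,5]]))) (Branch [1] (Branch [1,4] (Branch [3,4]
    (Branch [6] (Leaf [Push [0,1,3], Push [0,1,2], Push [2,5,6], Push [0,2,4,5], Move [5,6]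
    [0,1,3,4,5], Move [1,6] [0,4,5], Push [2,4,5], Push [2,4,5,6], Push [0,4,6], Push [0,4,5],
    Push [0,1,2,4,6]]) (Leaf [Push [6], Push [2,5], Move [3] [0,2,4,5,6], Move [2,3] [0,4,5],
    Push [2,4,5], Push [2,4,5,6], Push [2,5,6], Move [3,5,6] [0,4,5], Push [0,4,5,6], Push
    [0,1,3], Push [0,4,6], Push [0,4,5], Push [0,1,2]])) (Leaf [Push [3,4], Push [2,5], Push
    [0,1,3], Push [2,4,5,6], Push [2,5,6], Move [1,5] [0,4,5,6], Push [0,4,5], Push [0,4,6],
    Push [0,1,2]])) (Leaf [Push [1,4], Push [2,5,6], Push [0,1,3], Push [1,2,4,5,6], Push
    [0,1,2], Push [2,5], Push [0,4,6], Push [0,2,4,5], Push [0,4,5], Push [0,2,4,5,6]])) (Branch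
    [1,4] (Branch [0,2] (Leaf [Push [1,2,4,5], Push [0,1,3,4,6], Move [2,4] [0,1,2], Move [0,5]
    [0,1,3], Push [1], Push [0,1,3], Push [2,5,6], Push [0,1,2], Push [2,5], Push [0,4,6], Push
    [0,2,4,5], Push [0,4,5]]) (Leaf [Push [0,2,4,5], Push [1], Push [0,2], Push [0,4,5], Push
    [0,1,2,3], Push [0,1,3], Push [0,4,6], Push [1,2,4,5,6], Push [1,2,4,5], Push [2,4,5,6],
    Push [1,2,5,6], Push [0,1,2]])) (Branch [0] (Leaf [Push [1,4], Push [2,5,6], Push
    [1,2,4,5,6], Push [2,5], Push [1], Push [0,4,6], Push [0,2,4,5], Push [0,1,3], Push
    [0,2,4,5,6], Push [0,4,5], Push [0,1,2]]) (Branch [1,4,6] (Leaf [Push [0,4,6], Push [0,1,3],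
    Push [0,2,5], Push [2,4,5], Push [1,4], Push [0,1], Push [2,4,5,6]]) (Leaf [Push [0,1,3],
    Push [0], Push [0,4,6], Push [1,4,6], Push [2,4,5], Push [0,1], Push [1,2,4,5], Push [1,4],
    Push [0,2,5,6], Push [1,2,5,6], Push [0,2,4,5]]))))))))"
    by code_simp
  from fc_family_if_verify[OF this, of "[a, b, c, d, e, f, g]"] assms show ?thesis by simp
qed

text \<open>The triples through \<open>e\<close> attach to the two points of the shared pair
  \<open>{a, b}\<close>. Exchanging \<open>a\<close> with \<open>b\<close> and \<open>f\<close> with
  \<open>g\<close> is a symmetry, which the weights respect.\<close>

lemma fc_012_013_045_146:
  assumes "distinct [a, b, c, d, e, f, g]"
  shows "fc_family {{a, b, c}, {a, b, d}, {a, e, f}, {b, e, g}}"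
proof -
  have "verify [[0, 1, 2], [0, 1, 3], [0, 4, 5], [1, 4, 6]] [2, 2, 1, 1, 2, 1, 1]
    (Branch [4] (Branch [3,6] (Branch [6] (Branch [3,5] (Branch [5] (Leaf [Push [0,1,2,3,4,5],
    Push [0,1,2,3], Push [0,1,3,4,5,6], Move [2] [0,1,4,5,6], Push [0,1,2], Move [] [0,1,4,5,6],
    Move [3] [0,1,3,4,6], Move [2,3,6] [0,4,5], Push [1,4,6], Move [3,5,6] [0,4,5], Push
    [0,1,3], Push [0,4,5], Push [0,1,3,4,5], Push [0,1,2,4,6]]) (Leaf [Push [0,4,5], Push
    [1,4,5,6], Push [0,1,3], Push [1,4,6], Push [0,1,2], Push [0,1,3,4,6], Push [0,1,2,4,6]]))
    (Branch [4,6] (Leaf [Push [3,5], Push [0,1,2,4,6], Push [0,1,2,3], Push [0,4,5], Push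
    [0,1,3], Push [0,1,2], Push [0,3,4,5], Push [1,4,6], Push [0,1,3,4,6], Push [1,3,4,5,6],
    Push [0,1,4,5,6]]) (Leaf [Push [0,1,2,3], Push [0,1,2], Push [0,1,3], Push [3,5], Push
    [1,4,6], Push [4,6], Push [0,4,5], Push [3,4,5,6], Push [0,3,4,5,6]]))) (Branch [3,5,6]
    (Leaf [Push [0,1,4,5,6], Push [0,1,3,4,6], Push [0,1,2,3,6], Move [5] [0,1,2,3,4,5], Move
    [0] [0,1,3,4,5], Move [2,6] [0,4,5], Move [2,3,6] [0,4,5], Push [0,4,5,6], Push [0,1,2,3],
    Push [1,4,6], Push [0,1,3], Push [0,4,5], Push [0,1,2]]) (Branch [4,6] (Leaf [Push
    [0,1,2,4,5], Push [0,1,2,3], Push [0,1,3], Push [0,1,2], Push [1,3,4,5,6], Push [3,5,6],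
    Push [0,4,5], Push [1,4,6]]) (Leaf [Push [4,6], Push [0,1,2,3], Push [0,1,2], Push
    [0,1,3,4,5], Push [0,1,3], Push [3,5,6], Push [0,4,5], Push [1,4,6], Push [0,1,2,4,5], Push
    [1,3,4,5,6]])))) (Branch [0,3,6] (Branch [4,6] (Leaf [Push [3,6], Push [1,3,4,6], Push
    [1,4,6], Push [0,1,2,3], Push [0,1,2], Push [0,1,3,4,5], Push [0,1,3], Push [0,4,5], Push
    [0,1,2,4,5], Push [0,1,3,6], Push [0,3,4,5,6]]) (Leaf [Push [3,6], Push [4,6], Push
    [0,1,2,3], Push [0,1,2], Push [1,4,6], Push [0,1,3], Push [3,4,6], Push [0,4,5], Push
    [0,1,2,4,5], Push [0,1,3,4,5], Push [0,3,4,5,6]])) (Branch [2,3,6] (Leaf [Push [0,1,2,3],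
    Push [1,3,4,6], Push [0,4,5], Push [0,1,3], Push [0,3,6], Push [0,3,4,5,6], Push [1,4,6],
    Push [0,1,2], Push [0,1,2,4,5], Push [0,1,2,4,6], Push [0,1,3,4,5]]) (Branch [1] (Branch
    [4,5] (Branch [5,6] (Leaf [Push [1,4,6], Push [0,1,2,4,5], Push [2,3,6], Move [5]
    [0,1,2,3,6], Move [2,4] [0,1,2,3], Move [2,6] [0,4,5], Move [2,3] [0,4,5], Move [3] [0,4,5],
    Push [0,4,5], Push [0,1,3], Push [0,1,2], Push [0,2,3,6], Push [0,1,3,4,5], Push [0,3,6]])
    (Leaf [Move [2] [0,1,3,4,5], Move [6] [0,1,2,4,6], Move [3,4] [0,1,2,3], Push [0,1,3], Push
    [0,1,2], Push [3,5,6], Push [0,3,6], Push [5,6], Push [0,4,5], Push [1,4,6], Push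
    [0,2,3,6]])) (Leaf [Push [4,5], Push [0,1,2,3], Push [0,4,5], Push [0,1,2,4,6], Push
    [2,3,6], Push [0,1,3], Push [0,1,2], Push [0,3,6], Push [1,4,6], Push [0,2,3,6]])) (Branch
    [2,3] (Leaf [Push [1], Push [0,4,5], Push [0,1,2,3], Push [1,4,6], Push [0,1,2,4,6], Push
    [0,3,6], Push [0,1,2], Push [0,1,3], Push [2,3,6], Push [1,2,3,4,6], Push [0,2,3,6]])
    (Branch [4,6] (Leaf [Push [1,3,4,6], Push [0,1,2,4,6], Move [5,6] [0,1,2,3], Push [0,1,2,3],
    Push [0,3,6], Push [0,1,3], Push [2,3], Push [1], Push [0,1,2], Push [1,2,3], Push [1,4,6],
    Push [0,4,5]]) (Leaf [Push [1], Push [0,1,2], Push [0,1,3], Push [1,4,6], Push [0,4,5], Push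
    [1,2,3], Push [2,3,6], Push [2,3,4,6], Push [4,6]]))))))) (Branch [3,4,6] (Branch [4,6]
    (Leaf [Push [0,1,3,4,5,6], Push [0,1,2,4,6], Move [1] [0,1,4,5,6], Move [5,6] [0,1,2,3],
    Move [2,3] [1,4,6], Move [3,5,6] [0,4,5], Move [2,5,6] [0,1,2], Move [5] [1,4,6], Push [4],
    Push [1,4,6], Push [0,4,5], Push [0,1,3], Push [0,1,2]]) (Leaf [Push [4], Push [0,1,2,3],
    Push [0,1,3], Push [0,4,5], Push [1,4,6], Push [0,1,2], Push [0,4,5,6]])) (Branch [2,5]
    (Branch [5] (Leaf [Push [4], Push [1,3,4,6], Push [0,1,2], Push [0,1,3], Push [0,4,5], Push
    [1,4,6], Push [3,4,6], Push [0,1,4,5,6], Push [0,1,2,3], Push [0,3,4,5,6]]) (Leaf [Push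
    [1,4,6], Push [4], Push [0,4,5], Push [0,1,2], Push [0,1,3], Push [3,4,6], Push [0,1,2,3],
    Push [0,3,4,5,6], Push [4,5], Push [3,4,5,6]])) (Branch [1] (Leaf [Push [4], Push [1,4,6],
    Push [0,4,5], Push [3,4,6], Push [2,4,5], Push [0,1,3], Push [0,1,2], Push [0,1,2,3,5]])
    (Leaf [Push [1,4,6], Push [1,4], Push [2,5], Move [6] [0,1,2,3,5], Move [2,3] [0,2,4,5],
    Move [2,5,6] [0,2,4,5], Move [0,5,6] [1], Push [0,4,5], Push [4], Push [3,4,6], Push
    [0,1,3], Push [0,1,2]])))))"
    by code_simp
  from fc_family_if_verify[OF this, of "[a, b, c, d, e, f, g]"] assms show ?thesis by simp
qed

text \<open>A triangle of triples with corners \<open>a\<close>, \<open>c\<close>, \<open>e\<close>,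
  one side of which shares the pair \<open>{a, b}\<close> with the remaining triple.\<close>

lemma fc_012_013_045_246:
  assumes "distinct [a, b, c, d, e, f, g]"
  shows "fc_family {{a, b, c}, {a, b, d}, {a, e, f}, {c, e, g}}"
proof -
  have "verify [[0, 1, 2], [0, 1, 3], [0, 4, 5], [2, 4, 6]] [4, 3, 3, 1, 3, 2, 2]
    (Branch [2,5] (Branch [2] (Branch [1] (Branch [1,4] (Branch [4] (Branch [3,6] (Leaf [Push
    [0,1,2,3,4,5,6], Move [6] [0,1,2,4,5], Move [] [0,1,2,3,4,5], Move [5,6] [0,1,2], Move [5]
    [0,1,2,4,5], Move [1,6] [0,4,5], Move [4,6] [0,1,3], Move [0,3] [2,4,6], Move [3,4,6]
    [0,4,5], Move [2,3,6] [0,1,2,3], Move [2,6] [0,1,2], Move [3,5,6] [0,1,3], Move [1,3,5]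
    [2,4,6], Move [0,6] [0,4,5], Move [3,4,5] [0,1,3], Move [2,5,6] [0,1,3], Move [1,2,6]
    [0,2,4,5,6], Move [5] [2,4,6], Move [3,5] [2,4,6], Move [1,4,6] [0,4,5], Move [1,3,5,6]
    [2,4,6], Push [0,1,2], Push [0,4,5], Push [0,1,2,3], Push [2,4,6], Push [0,1,3], Push
    [0,1,2,4,6], Push [0,2,4,5,6]]) (Leaf [Push [0,1,2,3,4,6], Push [3,6], Push [0,1,2,3,6],
    Move [] [0,1,2,4,6], Move [1,3] [0,1,3,4,5], Move [0,3] [2,4,6], Push [2,3,4,6], Move [0,6]
    [2,4,6], Push [2,4,6], Push [0,4,5], Push [0,1,2], Push [0,1,3], Push [0,1,2,4,5]])) (Branch
    [5] (Leaf [Push [0,1,2,4,5,6], Move [0] [0,2,4,5,6], Move [3,5] [0,2,4,5,6], Move [2,3,5]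
    [0,1,3], Move [1,6] [0,4,5], Move [2,3] [0,4,5], Move [3,6] [0,4,5], Move [2,4] [0,4,5],
    Push [0,4,5], Move [3] [0,1,2], Move [0,3,5] [0,1,2,3], Push [0,1,3], Push [4], Push
    [2,4,6], Push [0,1,2]]) (Leaf [Push [0,1,2,4,6], Push [4], Push [0,4,5], Push [0,1,2], Push
    [0,1,3], Push [0,1,3,5], Push [4,5], Push [2,4,6], Push [2,4,5,6], Push [0,2,4,5,6]])))
    (Leaf [Push [0,2,4,5,6], Move [6] [0,1,3,4,5], Move [5,6] [0,1,2], Move [3,5] [1,2,4,6],
    Move [0,3] [2,4,6], Move [4,6] [0,1,3], Move [3,6] [0,1,2], Move [5] [0,1,2,3], Push
    [0,1,2,3], Push [1,4], Push [0,4,5], Push [0,1,2], Push [2,4,6], Push [0,1,3]])) (Branch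
    [1,5] (Branch [6] (Leaf [Push [0,1,3,4,5], Push [1], Move [3,5] [1,2,4,6], Move [4,5]
    [1,2,4,6], Push [0,4,5], Push [2,4,6], Push [0,1,2], Push [0,1,3], Push [0,2,4,5,6]]) (Leaf
    [Push [1,2,4,6], Push [1,6], Push [0,1,2,3], Push [0,1,3,6], Push [0,1,3], Push [1], Push
    [2,4,6], Push [0,4,5], Push [0,1,2], Push [0,2,4,5,6]])) (Branch [4] (Leaf [Push
    [1,2,4,5,6], Push [0,1,2,4,5], Move [3,6] [0,1,2,5], Move [6] [0,1,3,4,5], Push [0,1,3,5],
    Push [1,5], Move [3,5] [0,2,4,5,6], Move [3,4] [0,1,2,3], Push [0,1,2,3], Push [0,1,3], Push
    [0,4,5], Push [1], Push [2,4,6], Push [0,1,2]]) (Leaf [Push [1,2,4,6], Push [1,5], Push [4],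
    Push [1,4], Push [0,4,5], Push [0,1,2], Push [2,4,6], Push [0,1,3], Push [0,2,4,5,6], Push
    [0,1,3,4,5], Push [0,1,2,3,5], Push [0,1,3,5]])))) (Branch [3,5] (Branch [1] (Leaf [Push
    [0,1,2,3,4,5,6], Push [0,1,2,4,5,6], Move [3] [0,1,2,4,6], Move [3,6] [0,2,4,5,6], Move []
    [0,1,2,4,6], Move [1,5] [2,4,6], Move [0,3] [2,4,6], Move [4,6] [0,1,3], Move [1,4] [0,4,5],
    Move [3,4,5] [2,4,6], Push [2,4,6], Push [2], Push [0,1,3], Push [0,4,5], Push [0,1,2]])
    (Leaf [Push [0,1,3,4,5], Push [2], Push [1], Push [0,1,2,3], Push [0,1,2], Push [2,4,6],
    Push [0,1,3], Push [1,2,4,6], Push [0,2,4,5], Push [0,1,4,5], Push [1,2], Push [0,4,5]]))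
    (Branch [6] (Leaf [Push [0,1,3], Push [2], Push [2,3,5], Push [2,3,4,5,6], Move [3]
    [0,1,2,4,6], Push [0,1,2,3], Push [0,3,4,5], Push [2,4,6], Push [0,4,5], Push [0,1,2], Push
    [0,1,2,4,6]]) (Leaf [Push [2], Push [2,3,5], Push [2,3,4,5,6], Push [3,5,6], Push [2,4,6],
    Push [0,1,3], Push [2,6], Push [0,1,2], Push [0,4,5], Push [0,4,5,6]])))) (Branch [0]
    (Branch [4] (Branch [1] (Leaf [Push [2,5], Move [3,6] [0,1,2,3,5], Move [6] [0,1,3,4,5],
    Move [] [0,1,2,3,4,6], Move [3] [0,2,4,5,6], Push [2,4,5,6], Push [2,4,6], Move [2]
    [0,1,2,4,6], Move [5,6] [0,1,2], Push [0,1,2], Push [0,4,5], Push [0,1,3]]) (Leaf [Move [3]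
    [0,2,4,5,6], Move [3,6] [0,1,4,5], Move [5,6] [0,1,2], Move [0,3] [2,4,6], Push [2,4,6],
    Move [6] [0,1,2,3,5], Move [4,6] [0,1,3], Move [2,4] [0,1,2], Move [0,3,6] [2,5], Push [1],
    Push [0,1,3], Push [1,2,5], Push [2,5], Push [0,4,5], Push [0,1,2]])) (Branch [6] (Leaf
    [Push [2,5], Push [4], Move [3] [0,2,4,5,6], Push [0,4,5], Push [2,4,6], Push [0,1,3], Push
    [0,1,2], Push [0,1,2,3,5], Push [0,1,3,4,5], Push [2,4,5,6], Push [2,4,5]]) (Branch [3]
    (Leaf [Push [2,4,6], Push [0,1,3], Push [4,6], Push [0,4,5], Push [2,4,5], Push [0,4,5,6],
    Push [0,1,2], Push [2,5,6]]) (Leaf [Push [4], Push [2,5], Push [2,5,6], Push [2,3,4,5], Push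
    [3,4], Push [2,4,6], Push [0,1,3], Push [4,6], Push [0,4,5], Push [0,4,5,6], Push
    [0,1,2]])))) (Branch [1] (Branch [6] (Leaf [Push [0,1,2,3], Push [0], Push [0,2,4,5,6], Push
    [2,5], Push [0,1,3], Push [0,4,5], Push [2,4,6], Push [2,4,5,6], Push [0,2,5], Push
    [0,1,3,4,5], Push [0,1,2], Push [0,2,4,6], Push [0,1,2,5]]) (Leaf [Push [0,2,4,5], Push
    [0,2,4,6], Push [0,2,5], Push [6], Move [3,4] [0,1,3,6], Push [0,6], Push [2,5], Push
    [2,4,5,6], Push [0], Push [0,1,3], Push [2,4,6], Push [0,1,2,3], Push [0,4,5], Push [0,1,2],
    Push [0,4,5,6]])) (Branch [4] (Leaf [Push [0], Push [0,1,3], Push [0,1,2], Push [2,4,6],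
    Push [0,4,5], Push [1,2,5], Push [2,4,5,6], Push [0,1,2,3,5], Push [0,1], Push [0,1,3,4,5],
    Push [0,2,4,5,6], Push [0,1,4,5]]) (Leaf [Push [0], Push [0,1,3], Push [0,2,5], Push
    [2,4,5,6], Push [1,4], Push [0,1,3,4], Push [1,2,5], Push [1,2,4,6], Push [0,1,4,5], Push
    [0,2,4,6], Push [0,4,5], Push [0,1,2,3,5], Push [0,1,2]])))))"
    by code_simp
  from fc_family_if_verify[OF this, of "[a, b, c, d, e, f, g]"] assms show ?thesis by simp
qed

text \<open>Both \<open>{a, b}\<close> and \<open>{e, f}\<close> lie in two triples. The case
  analysis meets this family with either of them as the pair it starts from.\<close>

lemma fc_012_013_045_456:
  assumes "distinct [a, b, c, d, e, f, g]"
  shows "fc_family {{a, b, c}, {a, b, d}, {a, e, f}, {e, f, g}}"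
proof -
  have "verify [[0, 1, 2], [0, 1, 3], [0, 4, 5], [4, 5, 6]] [4, 3, 2, 2, 3, 3, 2]
    (Branch [2,6] (Branch [6] (Branch [3,6] (Branch [4] (Branch [5] (Branch [1,6] (Branch [2,4]
    (Branch [2] (Leaf [Push [0,1,2,3], Push [0,1,3], Push [0,1,2], Push [4,5,6], Push [0,4,5],
    Push [0,4,5,6], Push [0,1,2,4,5,6], Push [0,1,3,4,5,6], Push [0,1,3,4,5], Push [0,1,2,4,5],
    Push [0,1,2,3,4,5]]) (Branch [0,2,3] (Leaf [Push [0,1,3], Push [0,1,2], Push [4,5,6], Push
    [0,4,5], Push [0,2,4,5,6], Push [0,1,3,4,5,6], Push [0,4,5,6], Push [2,4,5,6]]) (Leaf [Push
    [0,1,3], Push [0,1,2], Push [0,4,5], Push [0,1,3,4,5,6], Push [0,2,3], Push [0,4,5,6], Push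
    [2], Push [4,5,6], Push [2,4,5,6]]))) (Leaf [Push [0,1,3], Push [2,4], Push [0,1,2], Push
    [0,1,3,4,5,6], Push [0,1,2,3,4], Push [0,4,5], Push [0,2,4,5,6], Push [0,4,5,6], Push
    [2,4,5,6]])) (Leaf [Push [1,6], Push [0,1,2,3], Push [4,5,6], Push [0,1,3,4,5], Push
    [0,1,3,6], Push [0,1,2], Push [0,1,2,4,5], Push [0,4,5,6], Push [0,1,3], Push [0,4,5]]))
    (Branch [3,5] (Leaf [Push [5], Push [0,1,2,3], Push [0,1,3], Push [0,4,5,6], Push [0,1,2],
    Push [0,4,5], Push [4,5,6], Push [0,1,2,5]]) (Branch [2,3,5] (Leaf [Push [0,1,2], Push
    [4,5,6], Push [0,1,3], Push [3,5], Push [0,3,4,5], Push [0,1,2,3,5], Push [0,4,5], Push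
    [3,4,5,6], Push [0,4,5,6]]) (Leaf [Push [5], Push [2,3,5], Push [0,1,2], Push [4,5,6], Push
    [0,1,3], Push [0,4,5,6], Push [0,4,5], Push [0,1,2,3,5], Push [2,3,4,5,6]])))) (Branch [2,4]
    (Branch [3,4] (Leaf [Push [4,5,6], Push [0,1,3,4,5], Push [0,1,2,3,4], Push [4], Move [5,6]
    [0,1,3], Move [5] [0,1,3], Move [3,4,6] [0,1,3], Move [5] [0,1,2], Move [2,4,6] [0,1,2],
    Move [4,6] [0,1,3], Move [4,6] [0,1,2], Move [1,6] [0,1,3], Move [1,6] [0,1,2], Move [1,5,6]
    [0,1,2], Push [0,1,2,3], Push [0,4,5], Push [0,4,5,6]]) (Leaf [Move [2,3] [0,3,4,5,6], Push
    [3,4,5,6], Push [3,4], Push [4,5,6], Push [0,1,2,3,4], Push [0,4,5,6], Push [0,4,5], Push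
    [0,1,2], Push [0,1,3], Push [0,3,4,5]])) (Branch [3,4] (Leaf [Move [2,3] [0,4,5,6], Push
    [2,4,5,6], Push [2,4], Push [4,5,6], Push [0,1,2,3,4], Push [0,4,5,6], Push [0,4,5], Push
    [0,1,3], Push [0,1,2], Push [0,2,4,5]]) (Branch [5] (Leaf [Push [0,1,3], Push [2,3,4], Push
    [2,4,5,6], Push [0,1,3,4], Push [2,4], Push [4], Push [0,4,5,6], Push [3,4], Push [0,1,2],
    Push [0,4,5], Push [4,5,6]]) (Leaf [Move [1] [0,4,5,6], Move [4,6] [0,1,3], Move [1,6]
    [0,1,2,4], Move [1,3] [2,4,5,6], Move [1,2] [4,5,6], Move [1,5] [0,4,5], Move [2,3,6]
    [0,1,3], Move [1,4] [3,4,5,6], Move [0,6] [2,3,4], Move [1,3,6] [2,4], Move [2] [0,1,3],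
    Push [0,1,2], Push [0,1,3], Push [0,1,2,3], Push [0,1,3,5], Push [2,4,5,6], Move [0,3]
    [2,4], Push [4], Push [2,4], Push [3,4], Push [5], Push [2,3,4,5], Push [4,5,6]])))))
    (Branch [2,3,6] (Leaf [Push [3,6], Push [0,1,2,3], Push [4,5,6], Push [0,1,3,6], Push
    [0,1,2,4,5,6], Push [3,4,5,6], Push [0,4,5], Push [0,1,3], Push [0,3,4,5,6], Push [0,1,2],
    Push [0,1,2,4,5], Push [0,1,3,4,5]]) (Branch [5] (Branch [1,3] (Leaf [Push [3,4,5,6], Push
    [2,3,6], Push [0,1,2,4,5], Push [3,6], Push [0,1,2,3,6], Push [0,1,3,4,5], Move [3,4]
    [0,1,3,6], Move [2,5] [0,1,2], Push [0,1,3], Push [0,1,2], Push [0,4,5,6], Push [4,5,6],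
    Push [0,4,5], Push [0,1,2,3]]) (Leaf [Push [2,3,6], Push [0,1,2,4,5], Push [3,6], Push
    [0,1,2], Push [4,5,6], Push [0,1,3,4,5], Push [0,1,3], Push [0,1,3,6], Push [1,3], Push
    [0,4,5], Push [0,4,5,6]])) (Branch [3,4] (Leaf [Push [2,3,6], Push [0,1,2,4,5,6], Push [5],
    Push [0,1,2], Push [0,4,5], Push [3,4,5,6], Push [0,1,3,6], Push [4,5,6], Push [0,1,3], Push
    [0,4,5,6], Push [0,1,2,3]]) (Leaf [Push [0,4,5], Push [0,1,2], Push [3,4], Push [2,3,6],
    Push [3,5,6], Push [2,3,4,6], Push [5], Push [3,4,5], Push [4,5,6], Push [2,3,4,5,6], Push
    [2,3,5,6]]))))) (Branch [0,6] (Branch [3,6] (Branch [2,3,5,6] (Leaf [Push [0,4,5,6], Push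
    [6], Push [0,1,3], Push [4,5,6], Push [0,4,5], Push [0,1,2,6], Push [0,1,2,4,5], Push
    [0,1,2], Push [0,1,2,3,4,5], Push [0,1,2,3,6]]) (Leaf [Push [0,4,5], Push [0,1,3], Push
    [0,1,2,6], Push [4,5,6], Push [0,1,2], Push [2,3,5,6], Push [2,3,4,5,6], Push [0,1,3,4,5]]))
    (Branch [2,3,6] (Leaf [Push [3,6], Push [0,1,2,3,6], Push [4,5,6], Push [3,4,5,6], Push
    [0,4,5], Move [2,5] [0,3,4,5,6], Push [0,1,2,3], Push [0,1,2,4,5], Push [0,1,3], Push
    [0,1,2]]) (Leaf [Push [6], Push [0,1,2,4,5], Push [2,3,6], Push [0,1,3], Push [0,4,5], Push
    [4,5,6], Push [2,3,4,5,6], Push [0,4,5,6], Push [0,1,2,6], Push [0,1,2], Push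
    [0,1,2,3,6]]))) (Branch [3,6] (Leaf [Push [6], Push [0,6], Push [0,1,2,3], Push [4,5,6],
    Push [0,1,2,6], Push [0,1,3,6], Move [] [0,1,3,4,5], Move [0] [0,1,2,4,5], Push [0,1,3],
    Push [0,4,5], Push [0,1,2], Push [0,1,2,3,4,5]]) (Branch [2,3,6] (Leaf [Push [0,6], Push
    [3,6], Push [0,3,6], Move [3] [0,1,2,4,5], Move [] [0,1,2,4,5], Push [0,4,5], Push [0,1,2],
    Push [3,4,5,6], Push [0,1,3], Push [0,3,4,5,6], Push [4,5,6], Push [0,1,2,3,6]]) (Leaf [Push
    [0,1,2,3], Push [0,1,3,4,5], Push [0,1,2,4,5], Push [2,3,6], Push [0,6], Push [3,4,5,6],
    Push [3,6], Push [0,4,5,6], Push [0,1,3,6], Push [0,4,5], Push [4,5,6], Push [0,1,2], Push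
    [0,1,3], Push [0,2,3,6], Push [0,1,2,6]]))))) (Branch [2,3,6] (Branch [5] (Branch [3,4]
    (Leaf [Push [2,6], Push [0,1,2,3,6], Push [0,1,2,6], Push [2,4,5,6], Move [] [0,1,3,4,5,6],
    Move [2] [0,1,2,3,4,5], Move [0] [0,1,3,4,5], Push [0,4,5], Push [0,1,2], Push [4,5,6], Push
    [0,1,3], Push [0,1,2,3]]) (Leaf [Push [0,4,5], Push [0,1,3], Push [0,1,2,6], Push [4,5,6],
    Push [3,4], Push [2,3,4,6], Push [0,1,2], Push [2,3,4,5,6], Push [2,6]])) (Leaf [Push [2,6],
    Push [5], Push [0,1,3,4,5,6], Push [0,1,2,3,6], Push [0,1,2,3], Push [2,5,6], Push [0,4,5],
    Push [2,4,5,6], Push [0,2,4,5,6], Push [0,1,3], Push [0,1,2], Push [4,5,6], Push [0,1,2,6],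
    Push [0,4,5,6]])) (Branch [0] (Branch [5] (Branch [4] (Branch [1] (Leaf [Push [2,3,6], Push
    [2,4,5,6], Push [2,6], Move [6] [0,1,3,4,5], Move [] [0,1,3,4,5], Move [3,6] [0,4,5], Move
    [2,3] [0,4,5], Push [0,4,5], Push [0,1,2,3,6], Push [4,5,6], Push [0,1,2,4,5], Move [3,5]
    [0,1,3], Move [3,4] [0,1,3], Push [0,1,2], Push [0,1,3]]) (Leaf [Push [2,3,6], Push
    [0,1,3,4,5], Push [1], Push [0,1,3], Push [0,1,2], Push [4,5,6], Push [0,1,2,6], Push
    [0,4,5]])) (Branch [4,5] (Leaf [Move [1] [2,3,4,5,6], Move [3] [0,4,5,6], Move [2,5]
    [0,1,3], Move [1,6] [0,4,5,6], Move [] [0,4,5,6], Move [1,3] [4,5,6], Move [3,5] [0,1,3],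
    Move [0,5] [2,3,6], Move [2,5,6] [0,1,2], Move [3] [0,4,5], Move [3,5,6] [0,1,3], Move [5,6]
    [0,1,2], Move [1,2] [0,1,3], Push [0,1,2], Move [0,1] [0,4,5,6], Push [4,5,6], Push [4],
    Push [2,6], Push [0,1,3], Push [2,3,6], Push [0,1,2,3,6], Push [0,4,5]]) (Leaf [Push
    [2,3,6], Push [2,6], Push [0,1,2,3,6], Push [4], Push [4,5], Push [0,4,5,6], Push
    [2,3,4,5,6], Push [2,4,5,6], Push [4,5,6], Move [2,5] [0,1,2], Push [0,1,3], Push [0,1,2],
    Push [0,4,5]]))) (Branch [3,4] (Branch [1,5] (Leaf [Push [5], Push [0,1,3], Push [0,4,5],
    Push [4,5,6], Push [2,3,6], Push [0,1,2], Push [0,1,2,3,6], Push [2,3,4,5,6], Push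
    [2,3,5,6], Push [0,1,2,6]]) (Leaf [Push [2,3,6], Push [1,4,5,6], Push [2,6], Push [5], Push
    [1,5], Push [0,1,3], Push [0,4,5,6], Push [0,4,5], Push [0,1,2], Push [0,1,2,3,6], Push
    [0,1,2,6]])) (Leaf [Push [5], Push [0,4,5], Push [4,5,6], Push [3,4,5], Push [3,4], Push
    [0,1,3], Push [2,3,4,6], Push [2,3,5,6], Push [2,6], Push [0,1,2]]))) (Branch [1] (Branch
    [1,3] (Leaf [Push [2,3,6], Push [2,3,4,5,6], Move [3] [0,1,2,3,4,5], Move [] [0,1,3,4,5,6],
    Move [0] [0,1,3,4,5], Move [1,6] [0,4,5,6], Move [0] [0,1,2,4,5], Move [3,6] [0,4,5], Move
    [2,3] [0,4,5], Move [0,6] [0,4,5], Move [1,5] [4,5,6], Push [4,5,6], Push [0], Push [0,4,5],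
    Push [2,6], Push [0,1,3], Push [0,1,2,6], Push [0,1,2], Push [0,1,2,3,6]]) (Leaf [Push
    [1,2,3,6], Move [1,3] [0,1,2,4,5], Move [2] [0,1,2,4,5], Move [1,3] [0,1,3,4,5], Move [2,3]
    [0,4,5], Move [2,5] [0,1,2,6], Move [3,5] [0,1,2,3], Move [1,6] [0,4,5,6], Push [0,4,5,6],
    Move [3,4] [0,1,2], Push [0,4,5], Push [0], Push [1,3], Push [2,6], Push [0,1,2,6], Push
    [0,1,2,3,6], Push [4,5,6], Push [0,1,3], Push [0,2,3,6], Push [0,1,2]])) (Branch [1,4,5]
    (Leaf [Push [1], Push [0], Push [0,1,3], Push [0,1,2,6], Push [0,4,5], Push [0,1,2,4,5],
    Push [4,5,6], Push [0,1], Push [0,2,3,6], Push [1,2,3,6], Push [0,1,2,3,6]]) (Branch [2,4,5]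
    (Leaf [Push [0], Push [1,2,3,6], Push [0,1,2,3,4,5], Push [1], Push [0,1,3], Push [0,2,6],
    Push [1,4,5], Push [0,1], Push [0,4,5], Push [0,1,2,6], Push [0,1,2,3,6], Push [4,5,6], Push
    [0,1,2]]) (Leaf [Push [0], Push [1], Push [0,1,3], Push [0,1,2,6], Push [0,4,5], Push
    [1,4,5], Push [0,1], Push [0,2,3,6], Push [1,2,3,6], Push [0,1,2,3,6], Push [2,4,5], Push
    [4,5,6]])))))))"
    by code_simp
  from fc_family_if_verify[OF this, of "[a, b, c, d, e, f, g]"] assms show ?thesis by simp
qed

text \<open>A closed chain of four triples; points on two of them weigh 2, the loose points
  \<open>f\<close> and \<open>g\<close> weigh 1.\<close>

lemma fc_012_013_245_346:
  assumes "distinct [a, b, c, d, e, f, g]"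
  shows "fc_family {{a, b, c}, {a, b, d}, {c, e, f}, {d, e, g}}"
proof -
  have "verify [[0, 1, 2], [0, 1, 3], [2, 4, 5], [3, 4, 6]] [2, 2, 2, 2, 2, 1, 1]
    (Branch [2,3] (Branch [3] (Branch [0] (Branch [1] (Branch [2] (Branch [4] (Leaf [Push
    [3,4,6], Move [6] [0,1,2,3,4,6], Move [3,5] [0,1,2,3,4,5], Move [4,6] [0,1,2,4,5], Move []
    [0,1,2,4,5], Move [0,4] [0,1,2,3], Move [1,4,6] [0,1,2], Move [4,5,6] [0,1,3,4,6], Move
    [2,5] [0,1,2,3,4,5], Move [0,4,6] [0,1,2], Move [2,6] [0,1,2,4,5], Move [1,4] [0,1,2], Push
    [2,4,5], Push [2,3,4,5,6], Push [0,1,2,3], Push [0,1,2], Push [0,1,3], Push [0,1,3,4,6],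
    Push [0,1,2,3,4,5,6]]) (Leaf [Push [4], Push [3,4,6], Push [0,1,3], Push [2,4,5], Push
    [2,3,4,5,6], Push [0,1,2], Push [0,1,2,4,5], Push [0,1,2,3], Push [0,1,3,4,6]])) (Branch
    [0,2] (Leaf [Push [2], Push [2,4,5], Push [3,4,6], Push [2,3,4,6], Push [0,1,2], Push
    [2,3,4,5,6], Push [0,1,3], Push [0,1,2,3,4,5], Push [0,1,2,3], Push [0,1,3,4,6], Push
    [0,1,2,4,5]]) (Leaf [Push [0,1,3], Push [2,4,5], Push [3,4,6], Push [2,3,4,5,6], Push
    [2,3,4,6], Push [0,2], Push [0,1,2], Push [0,1,2,3], Push [0,1,2,4,5], Push [0,1,3,4,6]])))
    (Branch [1,2] (Leaf [Push [1], Move [6] [0,1,2,4,5], Move [5,6] [0,1,2,3], Move [4]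
    [0,1,2,3], Move [1,6] [0,1,2,3], Move [0,2] [3,4,6], Move [1] [0,1,2,3], Move [3,4] [0,1,3],
    Push [2,4,5], Push [3,4,6], Push [2,3,4,5,6], Push [0,1,3], Push [1,3,4,6], Push [0,1,2],
    Push [0,1,3,4,6]]) (Leaf [Move [5] [0,1,3,4,6], Move [6] [0,1,2,4,5], Move [5,6] [0,1,2,3],
    Move [4] [0,1,2,3], Move [0,6] [2,3,4,5,6], Move [4,5] [0,1,3], Move [0,5] [3,4,6], Push
    [3,4,6], Move [0,5,6] [2,4,5], Push [0,1,3], Push [1], Move [3,4] [1,2], Push [2,4,5], Push
    [1,2], Push [0,1,2], Push [1,2,4,5]]))) (Branch [0,2] (Branch [1] (Leaf [Push [0,1,2,3],
    Push [0,1,3,4,6], Push [0,1,2,4,5], Move [1,6] [2,3,4,5,6], Move [3,5] [0,2,4,5], Move [6]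
    [2,3,4,5,6], Move [2,6] [0,3,4,6], Move [2,5,6] [0,2,4,5], Move [1,5] [3,4,6], Move [5]
    [0,3,4,6], Move [5] [0,1,3], Move [2,4] [3,4,6], Push [3,4,6], Push [0], Push [2,4,5], Push
    [0,1,2], Push [0,1,3]]) (Leaf [Push [0,1,2,3], Push [0], Push [2,4,5], Push [1,3,4,6], Push
    [0,1,3], Push [0,1,2,4,5], Push [3,4,6], Push [0,1,2], Push [0,1], Push [0,2,4,5], Push
    [1,2,4,5], Push [0,3,4,6]])) (Branch [1] (Leaf [Push [0,1,3,4,6], Push [0,1,2,3,4,5], Push
    [0,1,2,4,5], Push [0,2,4,5], Move [2,6] [0,1,3], Move [5] [0,1,2,3], Move [4] [0,1,2,3],
    Push [0,1,2,3], Move [4,5] [0,1,3], Move [1,5] [3,4,6], Push [3,4,6], Move [5,6] [0,1,3],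
    Push [0,1,3], Push [0], Move [3,4] [0,2], Push [2,4,5], Push [2,3,4,5,6], Push [0,1,2], Push
    [0,2]]) (Leaf [Push [0,1,2,3], Push [1], Push [3,4,6], Push [0,1,3,4,6], Move [6]
    [0,1,2,4,5], Push [0,1,2], Push [2,4,5], Push [0,2], Push [0,2,4,5], Push [1,2,4,5], Push
    [0,1,3], Push [0,1]])))) (Branch [1,3] (Branch [0,3] (Leaf [Push [3], Push [2,4,5], Push
    [3,4,6], Push [2,3,4,5], Push [0,1,2], Push [0,1,2,3,4,6], Push [0,1,3], Push [0,1,2,3],
    Push [0,1,3,4,6], Push [0,1,2,4,5]]) (Leaf [Push [0,1,2,4,5], Push [3], Move [5]
    [0,1,3,4,6], Move [4] [0,1,2,3], Move [5,6] [0,1,2,3], Move [2,6] [0,3,4,6], Move [6]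
    [0,1,2,3], Push [0,1,2,3], Push [0,1,2], Push [3,4,6], Push [2,4,5], Push [2,3,4,5], Push
    [2,3,4,5,6], Push [0,1,3], Push [0,3]])) (Branch [0] (Branch [4,5,6] (Leaf [Push [3], Push
    [3,4,6], Push [1,3], Push [0,1,3], Push [2,4,5], Push [0,1,2,3], Push [2,3,4,5,6], Push
    [0,1,2], Push [0,1,3,4,6], Push [1,3,4,6], Push [0,1,2,4,5]]) (Leaf [Push [3], Move
    [2,3,4,5] [0,1,3], Move [2,5] [0,1,3], Move [1,3,4,6] [0,1,3], Push [3,4,6], Push [2,3,4,5],
    Push [1,3], Push [4,5,6], Push [0,1,2,3], Move [] [0,1,2,4,5], Push [2,4,5,6], Push [2,4,5],
    Push [0,1,2], Push [0,1,3]])) (Branch [4,6] (Leaf [Push [0,1,2], Push [0,1,2,3], Push [0],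
    Push [1,3], Push [3,4,6], Push [0,1,3], Push [2,4,5], Push [0,1,3,4,6], Push [0,3], Push
    [1,3,4,6], Push [0,1,2,4,5]]) (Leaf [Push [0,1,2], Push [0,3], Push [4,6], Push [0,1,2,3],
    Push [1,3], Push [0,1,3], Push [0,4,6], Push [1,3,4,6], Push [3,4,6], Push [2,4,5], Push
    [0,1,3,4,6]]))))) (Branch [4,5] (Branch [4,6] (Branch [0,1] (Leaf [Push [2,3,4,5,6], Push
    [2,3,4,5], Move [3] [0,1,2,3,4,5,6], Move [5] [0,1,3,4,6], Move [5,6] [0,1,2,3], Move [6]
    [0,1,2,4,5], Move [] [0,1,3,4,6], Move [4] [0,1,2,3], Move [0] [2,3,4,6], Move [2]
    [0,1,2,4,5], Move [1,5] [3,4,6], Move [1] [2,3,4,6], Push [2,3], Move [0,5] [3,4,6], Move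
    [1,4,6] [0,1,2], Move [0,6] [2,4,5], Move [3,6] [0,1,3], Push [0,1,3], Push [2,4,5], Move
    [0,4,6] [0,1,2], Push [3,4,6], Push [0,1,2]]) (Leaf [Push [2,3,4,5,6], Push [2,3,4,5], Move
    [6] [0,1,2,4,5], Move [4] [0,1,2,3], Move [5,6] [0,1,2,3], Move [0] [2,3,4,6], Move [1]
    [2,3,4,6], Push [2,3], Push [0,1], Move [1,4,6] [0,1,2], Move [1,5] [3,4,6], Push [3,4,6],
    Push [0,1,3], Push [2,4,5], Push [0,1,3,4,6]])) (Branch [0,1] (Leaf [Push [2,4,5], Push
    [4,6], Push [2,3], Push [2,3,4,5], Push [2,3,4,5,6], Push [2,3,4,6], Move [5] [0,1,3,4,6],
    Move [5,6] [0,1,2,3], Move [4] [0,1,2,3], Move [1,5] [3,4,6], Move [0,5] [3,4,6], Push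
    [0,1,3], Push [0,1,2], Push [3,4,6], Push [0,1,2,4,5]]) (Leaf [Push [2,4,5], Push [0,1],
    Push [2,3], Push [0,1,3], Push [0,1,2,3], Push [2,3,4,5], Push [2,3,4,5,6], Push [4,6], Push
    [3,4,6], Push [2,3,4,6], Push [0,1,3,4,6]]))) (Branch [4,6] (Branch [6] (Leaf [Push [2,3],
    Push [2,4,5], Push [4,5], Push [3,4,6], Push [0,1,2], Push [2,3,4,5,6], Push [0,1,3], Push
    [0,1,2,4,5], Push [0,1,2,3], Push [2,3,4,6], Push [0,1,3,4,6]]) (Leaf [Push [3,4,6], Push
    [2,3,6], Push [4,5], Push [4,5,6], Push [2,3], Push [2,3,4,6], Push [0,1,2], Push [2,3,4,5],
    Push [2,4,5], Push [0,1,3], Push [0,1,2,3]])) (Leaf [Push [4,5,6], Push [4,6], Push [4,5],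
    Push [2,3], Push [2,3,4,5,6], Push [0,1,2], Push [0,1,3], Push [2,3,4,5], Push [2,3,4,6],
    Push [0,1,2,3]]))))"
    by code_simp
  from fc_family_if_verify[OF this, of "[a, b, c, d, e, f, g]"] assms show ?thesis by simp
qed

text \<open>A chain \<open>d\<close>, \<open>{a, b}\<close>, \<open>c\<close>,
  \<open>{e, f}\<close>, \<open>g\<close> in which each triple is a pair with a neighbouring point.
  Reversing it is a symmetry, and the middle point \<open>c\<close> weighs most.\<close>

lemma fc_012_013_245_456:
  assumes "distinct [a, b, c, d, e, f, g]"
  shows "fc_family {{a, b, c}, {a, b, d}, {c, e, f}, {e, f, g}}"
proof -
  have "verify [[0, 1, 2], [0, 1, 3], [2, 4, 5], [4, 5, 6]] [3, 3, 4, 2, 3, 3, 2]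
    (Branch [3,4] (Branch [3] (Branch [1,6] (Branch [6] (Branch [0,6] (Branch [3,5] (Branch
    [3,6] (Branch [0] (Branch [1,4] (Leaf [Push [4,5,6], Move [] [0,1,2,3,4,5,6], Push
    [0,1,3,4,5,6], Move [2] [0,1,2,4,5], Move [1,3] [2,4,5], Move [0,3] [2,4,5], Move [1]
    [2,4,5], Move [0,4] [2,4,5], Move [2,3] [2,4,5], Move [1] [2,4,5,6], Move [0,5] [2,4,5,6],
    Push [2,4,5,6], Push [0,1,3], Push [0,1,2], Push [0,1,2,4,5,6], Push [0,1,2,3], Push
    [0,1,2,3,4,5]]) (Leaf [Push [4,5,6], Push [2,4,5], Push [0,1,2,3], Push [0,1,2], Push [1,4],
    Push [1,2,4,5,6], Push [0,1,3], Push [2,4,5,6]])) (Branch [0,1,4] (Leaf [Push [0,1,2,3,4,5],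
    Push [0,1,2,4,5], Push [0,2,4,5], Move [4,6] [0,1,2], Move [5,6] [0,1,2], Move [5]
    [0,1,2,3], Move [4] [0,1,2,3], Move [4,5] [0,1,3], Push [0,1,3], Push [0,1,2], Push [0],
    Push [2,4,5], Push [0,4,5,6], Push [4,5,6], Push [2,4,5,6]]) (Leaf [Push [0,1,2,3,4], Push
    [0,2,4,5,6], Push [0,2,4,5], Push [0,4,5,6], Push [0,1,3], Push [0,1,2,3], Push [0], Move
    [5] [0,1,2], Move [5,6] [0,1,2], Move [3,4,6] [2,4,5], Push [2,4,5,6], Push [2,4,5], Push
    [4,5,6], Move [2,6] [0,1,2], Push [0,1,2,4], Push [0,1,4]]))) (Branch [1,4] (Leaf [Push
    [4,5,6], Push [0,1,2,3,6], Push [3,6], Push [2,4,5], Push [0,1,3], Push [0,1,2], Push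
    [2,3,4,5,6], Push [0,1,2,3], Push [2,4,5,6], Push [0,1,2,3,4,5], Push [0,1,2,4,5,6]]) (Leaf
    [Push [2,4,5], Push [0,1,2], Push [0,1,3], Push [4,5,6], Push [1,4], Push [2,3,4,5,6], Push
    [0,1,2,3,6], Push [0,1,2,3]]))) (Branch [0,4] (Leaf [Move [0] [2,3,4,5,6], Move []
    [0,1,2,4,5,6], Move [5] [0,1,2,4,5], Move [3,6] [0,1,2,3,5], Move [1] [2,4,5,6], Move [1,5]
    [2,3,4,5,6], Move [5,6] [0,1,2], Move [1,4] [0,1,2,3], Move [0,5] [2,4,5,6], Move [0,4,6]
    [0,1,2], Move [4,5,6] [2,4,5], Move [1,4,6] [0,1,2,3], Push [3,5], Push [2,4,5], Push
    [0,1,2], Push [4,5,6], Push [0,1,3]]) (Leaf [Push [0,1,2], Push [4,5,6], Push [2,4,5], Push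
    [0,1,2,3], Push [0,4], Push [3,5], Push [2,3,4,5,6], Push [0,1,3,5], Push [0,1,3,4]])))
    (Branch [5] (Branch [1] (Leaf [Push [4,5,6], Push [2,4,5], Push [0,1,2,6], Push [0,6], Push
    [0,1,3], Push [0,1,2], Push [0,1,2,3], Push [0,1,2,3,4,5], Push [0,2,4,5,6], Push
    [2,4,5,6]]) (Leaf [Push [2,4,5], Push [0,1,2,3,6], Push [4,5,6], Push [0,2,4,5,6], Push
    [0,6], Push [1,2,4,5,6], Push [1], Push [0,1,2], Push [0,1,3], Push [0,1,2,3], Push
    [0,1,3,6]])) (Branch [2] (Leaf [Push [0,1,3], Push [0,1,2], Push [5], Push [0,6], Push
    [0,5,6], Push [2,4,5], Push [2,4,5,6], Push [0,4,5,6], Push [0,1,2,3,6], Push [0,2,4,5,6],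
    Push [4,5,6]]) (Leaf [Push [0,4,5,6], Push [2], Push [0,1,3], Push [2,4,5], Push [0,1,2],
    Push [0,2,6], Push [4,5,6], Push [0,6], Push [0,1,2,3,6], Push [2,4,5,6], Push
    [0,1,2,3]])))) (Branch [3,5,6] (Branch [0,6] (Leaf [Push [2,4,5,6], Push [6], Push [0,1,3],
    Push [4,5,6], Move [] [0,1,2,3,4,5], Move [2] [0,1,2,4,5], Move [5] [0,1,2,3,6], Move [5,6]
    [0,1,2], Move [4,6] [0,1,2], Push [0,1,2,6], Push [0,1,2,3,6], Push [2,4,5], Push [0,1,2],
    Push [0,1,2,3]]) (Branch [2,6] (Leaf [Push [2,4,5], Push [0,1,3], Push [0,1,2,3], Push
    [4,5,6], Push [0,1,2], Push [2,4,5,6], Push [0,6], Push [0,1,2,6], Push [0,1,2,3,6], Push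
    [0,1,2,3,4,5], Push [0,2,4,5,6]]) (Leaf [Push [0,1,3], Push [4,5,6], Push [2,6], Push
    [2,4,5], Push [0,1,2], Push [0,1,2,3,4,5], Push [0,2,4,5,6], Push [2,4,5,6], Push
    [0,1,2,3,6], Push [0,1,2,3]]))) (Branch [0,4,6] (Leaf [Push [6], Push [0,1,3,6], Push
    [3,5,6], Push [0,1,3], Push [4,5,6], Push [2,4,5], Push [0,1,2,3], Push [2,3,4,5,6], Push
    [2,4,5,6], Push [0,1,2], Push [0,1,2,4,5]]) (Leaf [Push [3,5,6], Push [4,5,6], Push
    [0,1,2,3,4,5], Push [0,1,2,4,5], Push [6], Push [2,4,5], Move [4] [0,1,2,3], Move [2,4]
    [0,1,2], Push [0,4,6], Push [0,1,3], Push [2,3,4,5,6], Push [2,4,5,6], Push [0,1,2]]))))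
    (Branch [2,3] (Branch [2] (Branch [3,5] (Branch [1,2,6] (Leaf [Push [0,1,2,3,4,5], Push
    [0,1,2,4,5], Move [5] [0,1,2,3,6], Move [0,6] [2,4,5,6], Move [4] [0,1,2,3,6], Move [0,3]
    [2,4,5], Move [4,5] [0,1,3], Move [3,6] [2,4,5], Move [1,3] [2,4,5], Move [0] [1,4,5,6],
    Move [1] [2,4,5], Move [3,5,6] [1,4,5,6], Move [4,5,6] [2,4,5,6], Push [4,5,6], Push
    [2,4,5,6], Push [1,6], Push [0,1,3], Push [0,1,2], Push [2,4,5], Push [0,1,2,3]]) (Branch
    [1] (Leaf [Push [4,5,6], Push [1,2,6], Push [0,1,3], Push [0,1,2,3], Move [] [0,1,2,3,4,5],
    Push [0,1,2,4,5], Move [3,6] [1,2,4,5,6], Move [5] [0,1,2,3,6], Push [0,1,2,3,6], Push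
    [2,4,5], Push [0,1,2]]) (Leaf [Push [1,2,4,5,6], Push [0,1,2,3,4,5], Move [5] [0,1,2,3,6],
    Move [4] [0,1,2,3,6], Move [] [0,1,2,4,5], Move [4,6] [0,1,2], Move [0,6] [2,4,5,6], Move
    [5,6] [0,1,2], Push [1,2,6], Push [2,4,5], Push [2,4,5,6], Move [0] [1,4,5,6], Push
    [1,4,5,6], Move [4,5] [0,1,3], Move [2,5] [0,1,2], Move [1,2] [0,1,3], Move [2,4] [0,1,2],
    Push [1,6], Push [0,1,3,6], Push [0,1,2,3], Push [0,1,3], Push [1], Push [4,5,6]]))) (Leaf
    [Push [0,1,2], Push [3,5], Push [2,3,4,5], Push [1,6], Push [2,4,5], Push [0,1,3], Push
    [4,5,6], Push [2,4,5,6], Push [0,1,2,3,6], Push [0,1,3,5], Push [1,3,5,6]])) (Branch [4,5]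
    (Leaf [Push [0,1,3,4,5,6], Move [2] [0,1,2,3,4,5], Move [4,6] [0,1,2], Move [3,6]
    [1,2,4,5,6], Push [1,2,4,5,6], Move [5] [0,1,2,6], Move [1] [0,1,2,4,5], Move [3,5] [1,2,6],
    Move [0] [1,4,5,6], Move [2,5] [0,1,2], Move [3,5,6] [2,4,5], Move [3,4,6] [1,2,6], Move
    [1,2] [2,4,5], Move [0,3,4] [2], Move [2,4] [0,1,2], Move [0,2] [2,4,5], Move [3,4,5]
    [0,1,3], Move [0,3,5] [2], Push [1,6], Push [2], Push [0,1,2,3], Push [2,4,5], Push
    [0,1,3,6], Push [0,1,3], Push [0,1,2,3,6], Push [4,5,6]]) (Leaf [Push [2], Push [4,5], Push
    [1,6], Push [0,1,3,6], Push [0,1,2,3,6], Push [1,2,6], Push [2,4,5], Push [1,2,4,5,6], Push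
    [0,1,2], Push [0,1,2,3], Push [1,4,5,6], Push [0,1,3]]))) (Leaf [Push [2,3], Push [1,4,5,6],
    Push [2,3,4,5], Push [1,6], Push [0,1,3], Move [5] [0,1,2,3,6], Push [0,1,2,3,6], Push
    [2,4,5,6], Push [0,1,2], Push [2,4,5], Push [4,5,6], Push [0,1,2,4,5], Push [0,1,2,3], Push
    [1,2,3,6]]))) (Branch [2,3,6] (Branch [3,6] (Branch [2,3] (Leaf [Push [3], Push [0,1,2,3],
    Push [4,5,6], Push [2,3,4,5], Push [0,1,3], Push [0,1,2], Push [2,4,5], Push [2,4,5,6], Push
    [2,3,4,5,6], Push [0,1,2,4,5,6], Push [0,1,2,4,5]]) (Branch [1,4] (Leaf [Push [0,1,3], Push
    [2,3], Push [0,1,2,3], Push [2,3,4,5,6], Move [2] [0,1,2,4,5,6], Move [] [0,1,2,4,5], Move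
    [0,6] [2,4,5,6], Move [5] [0,1,2], Push [0,1,2], Push [4,5,6], Push [2,4,5], Push [2,3,4,5],
    Push [3,4,5,6], Push [2,4,5,6]]) (Leaf [Push [0,1,2], Push [4,5,6], Push [0,1,3], Push
    [2,3], Push [2,4,5], Push [1,2,3,4], Push [0,1,2,3,4], Push [2,3,4,5,6], Push [1,3,4]])))
    (Branch [1,3,6] (Leaf [Push [0,1,3], Push [0,1,2], Push [3], Push [0,1,2,3], Move [0,3]
    [2,4,5], Push [2,3,4,5], Move [0,1] [4,5,6], Move [0] [2,4,5], Push [2,4,5], Move [3,5]
    [0,1,2,3,6], Push [0,1,2,3,6], Push [4,5,6], Push [2,4,5,6], Push [3,4,5,6], Push
    [0,1,2,4,5]]) (Leaf [Push [0,1,3,4,5,6], Push [1,3,6], Push [3], Push [0,1,2,3], Push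
    [3,4,5,6], Push [2,3,4,5], Push [0,1,3], Push [0,1,2], Push [3,6], Push [4,5,6], Push
    [2,4,5], Push [2,4,5,6], Push [0,1,2,4,5]]))) (Branch [5] (Branch [2,5] (Branch [4,5] (Leaf
    [Push [3], Push [2,3,6], Push [2,3,4,5,6], Push [0,1,3], Push [0,1,2], Push [0,1,2,3,6],
    Push [4,5,6], Push [2,4,5], Push [2,3,4,5], Push [2,4,5,6], Push [0,1,2,4,5]]) (Leaf [Push
    [2,3,6], Push [2,3,4,5], Push [0,1,3], Push [0,1,2,3,6], Push [4,5], Push [4,5,6], Push
    [3,4,5], Move [6] [0,1,2,4,5], Move [1] [2,4,5], Push [2,4,5], Push [0,1,2], Push
    [2,4,5,6]])) (Leaf [Push [0,1,2,3], Push [2,4,5], Push [0,1,3], Push [2,3,6], Push [4,5,6],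
    Push [2,5], Push [0,1,2], Push [2,3,4,5,6], Push [2,3,5], Push [3,4,5,6]])) (Branch [2]
    (Leaf [Push [0,1,2,3], Push [2,3,6], Push [0,1,3], Push [3,5], Push [5], Push [2,4,5], Push
    [0,1,2], Push [2,3,4,5,6], Push [4,5,6], Push [3,4,5,6]]) (Branch [0,1,5] (Leaf [Push
    [0,1,2,4,5,6], Push [0,1,2,4,5], Push [0,1,2,3], Push [3], Push [2,3,6], Push [3,4,5,6],
    Push [2,3,4,5], Push [0,1,3], Push [2,3], Move [6] [0,1,2,5], Push [2,5], Push [2,4,5,6],
    Push [2,4,5], Push [4,5,6], Push [0,1,2]]) (Leaf [Push [0,1,2,4,5], Push [0,1,2,3], Push
    [3], Push [2,3,6], Push [3,4,5,6], Push [2,3,4,5], Push [0,1,3], Push [2,3], Push [0,1,2],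
    Push [2,5], Push [2,4,5,6], Push [2,4,5], Push [0,1,5], Push [4,5,6]])))))) (Branch [2]
    (Branch [2,6] (Branch [3,4,6] (Branch [5] (Leaf [Push [0,1,2], Push [0,1,3], Push [3,4],
    Push [4,5,6], Push [0,1,2,3], Move [1] [2,3,4,5,6], Push [2,3,4,5], Push [0,1,2,3,4], Push
    [2,4,5], Push [2,4,5,6], Push [0,1,3,4], Push [2,3,4,5,6], Push [0,1,2,4,5,6]]) (Leaf [Push
    [0,1,2], Push [0,1,3], Push [5], Push [0,1,2,3,4], Push [3,4], Push [2,4,5,6], Push
    [2,3,4,5], Push [2,4,5], Push [0,1,3,4], Push [0,1,2,3,5], Push [4,5,6], Push [3,4,5,6]]))
    (Branch [1,6] (Branch [6] (Branch [0,6] (Branch [0,4] (Leaf [Push [3,4,6], Push [3,4], Push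
    [0,1,3], Push [2,3,4,5], Move [] [0,1,2,4,5,6], Push [2,4,5,6], Push [0,1,2], Push [4,5,6],
    Push [2,4,5], Push [0,1,2,4,5]]) (Leaf [Push [0,1,3], Push [3,4,6], Push [2,3,4,5,6], Push
    [2,3,4,5], Push [0,3,4,6], Push [3,4], Move [4,6] [0,1,2,4], Push [0,1,2], Push [0,4], Push
    [4,5,6], Push [2,4,5,6], Push [2,4,5]])) (Leaf [Push [0,1,2], Push [0,1,3], Push [3,4], Push
    [2,4,5], Push [0,6], Push [4,5,6], Push [2,4,5,6], Push [2,3,4,5,6], Push [0,1,2,6], Push
    [0,1,3,4], Push [0,3,4,6], Push [3,4,5,6]])) (Branch [0] (Leaf [Push [3,4,6], Push [3,4],
    Push [6], Push [4,5,6], Push [2,4,5], Push [2,3,4,5,6], Push [2,4,5,6], Push [0,1,2], Push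
    [0,1,2,3,6], Push [0,1,3,6], Push [0,1,3]]) (Leaf [Push [3,4,6], Push [2,4,5,6], Push [0,6],
    Push [0,1,2], Push [2,4,5], Push [4,5,6], Push [0,1,3], Push [0,3,4], Push [2,3,4,5], Push
    [0,1,2,3,6]]))) (Branch [2,3] (Branch [0] (Leaf [Push [0,1,2,4,5], Push [3,4,6], Push
    [1,4,5,6], Push [1,6], Push [3,4], Push [2,4,5], Push [0,1,3], Push [2,3,4,5,6], Push
    [0,1,2], Push [0,1,2,3,6], Push [4,5,6]]) (Branch [4] (Leaf [Push [0,1,2], Push [0,3,4],
    Push [1,6], Push [3,4,6], Push [0,1,3], Push [0,1,2,6], Push [3,4], Push [2,4,5]]) (Branch
    [3,5] (Leaf [Push [0,1,2], Push [3,4], Push [0,1,3], Push [1,6], Push [2,4,5], Push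
    [0,3,4,6], Push [0,1,2,3], Push [0,1,2,3,6], Push [0,4], Push [1,3,4,6]]) (Leaf [Push [0,4],
    Push [3,4,6], Push [1,6], Push [0,1,2], Push [3,5], Push [2,4,5], Push [1,3,5,6]])))) (Leaf
    [Push [4,5,6], Push [2,4,5], Push [1,6], Push [2,3], Push [0,1,2,3], Push [0,1,2,6], Push
    [2,3,4], Push [2,3,4,5,6], Push [0,1,3,6], Push [0,1,2,4,5], Push [0,1,2], Push [3,4], Push
    [0,1,3], Push [1,2,3,6]])))) (Branch [5] (Leaf [Push [2,6], Push [0,1,3], Push [3,4], Push
    [2,3,4,5], Push [2,4,5,6], Push [0,1,2], Push [0,1,2,3,6], Push [4,5,6], Push [2,4,5], Push
    [3,4,5,6], Push [2,3,4,6], Push [0,1,2,4,5]]) (Leaf [Push [5], Push [2,5,6], Push [4,5,6],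
    Push [2,6], Push [0,1,2], Push [0,1,3], Push [3,4], Push [2,3,4,5], Push [2,3,4,6], Push
    [2,4,5]]))) (Branch [2,3,6] (Branch [2,3] (Leaf [Push [2], Push [0,1,3], Push [4,5,6], Push
    [2,4,5,6], Push [2,4,5], Push [3,4], Push [0,1,2], Push [2,3,4], Push [2,3,4,5], Push
    [0,1,2,3,4], Push [2,3,4,5,6], Push [0,1,2,4,5], Push [0,1,2,4,5,6]]) (Branch [0,1] (Leaf
    [Push [0,1,3,4,5,6], Push [0,1,2,3,4,5], Push [0,1,2,3,4], Move [] [0,1,2,4,5,6], Move [1]
    [2,3,4,5,6], Push [3,4,5,6], Push [2,3,4,5,6], Move [5] [0,1,2,4,5], Move [1,3] [2,4,5],
    Push [2,3,4,5], Push [2,3,4], Push [4,5,6], Push [2,3], Push [3,4], Push [2], Move [0]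
    [2,4,5,6], Push [2,4,5,6], Push [2,4,5], Push [0,1,2], Push [0,1,3], Push [0,1,2,3]]) (Leaf
    [Push [2], Push [0,1], Push [0,1,2], Push [0,1,2,3,4], Push [2,4,5,6], Push [2,4,5], Push
    [3,4,5,6], Push [3,4], Push [2,3,4], Push [0,1,3,4], Push [2,3,4,5], Push [4,5,6], Push
    [2,3,4,5,6]]))) (Branch [0,1] (Leaf [Push [2,3,4,5,6], Push [0,1,2,3,4,5], Push [2,3,4,6],
    Move [6] [0,1,2,4,5], Move [5] [0,1,2,3,6], Move [] [0,1,2,4,5], Move [1,6] [2,4,5], Move
    [0,6] [2,4,5], Move [5,6] [0,1,2], Move [1] [2,3,4,5], Move [0] [2,3,4,5], Push [2,3,4],
    Move [4,5] [0,1,3], Move [1,4] [2,4,5], Move [0,4] [2,4,5], Move [3,5,6] [0,1,3], Move [4]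
    [0,1,2], Move [2,5] [0,1,2], Move [0,1,6] [4,5,6], Push [2], Push [0,1,2], Push [2,3,6],
    Push [3,4], Push [4,5,6], Push [3,4,5,6], Push [0,1,3]]) (Leaf [Push [2,3,4,5,6], Push
    [2,3,4,6], Move [0,1] [0,1,2,4,5], Move [5] [0,1,2,3,6], Move [0] [2,4,5,6], Move [1,6]
    [2,4,5], Move [0,3] [2,3,4,5], Move [2,4] [0,1,2], Move [1,5] [2,3,6], Move [0,5] [2,3,6],
    Push [2,3,6], Move [2,5] [0,1,2], Move [0,4] [2,4,5], Move [1,4] [2,4,5], Push [2], Push
    [0,1,2], Move [3,4,5] [0,1,3,4], Move [4,5] [0,1,3], Push [3,4], Push [2,3,4], Push [0,1],
    Push [4,5,6], Push [3,4,5,6], Push [2,3,4,5], Push [0,1,3]])))))"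
    by code_simp
  from fc_family_if_verify[OF this, of "[a, b, c, d, e, f, g]"] assms show ?thesis by simp
qed

section \<open>Four triples that meet pairwise in at most one point\<close>

lemma fc_012_034_056_135:
  assumes "distinct [a, b, c, d, e, f, g]"
  shows "fc_family {{a, b, c}, {a, d, e}, {a, f, g}, {b, d, f}}"
proof -
  \<comment> \<open>Three triples through \<open>a\<close> and a transversal; \<open>a\<close> and
    the points of the transversal weigh 2, the others 1.\<close>
  have "verify [[0, 1, 2], [0, 3, 4], [0, 5, 6], [1, 3, 5]] [2, 2, 1, 2, 1, 2, 1]
    (Branch [3] (Branch [5] (Branch [1,4] (Branch [4] (Branch [0] (Leaf [Push [0,5,6], Move []
    [0,1,2,3,4,5,6], Move [2] [0,1,2,3,4,5], Push [0,1,2,3,4], Move [6] [0,1,2,3,5,6], Push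
    [0,1,2,5,6], Move [1,2] [0,1,2,3,5], Move [1,6] [0,3,4], Move [3,6] [0,1,2], Move [1,5]
    [0,1,2], Move [4,6] [0,1,2], Move [1] [0,3,4], Move [2,4,5] [0,3,4], Move [2,3] [0,1,2],
    Push [1,3,5], Push [0,1,3,4,5], Push [0,3,4], Push [0,1,2], Push [0,3,4,5,6]]) (Leaf [Push
    [0,1,3,5,6], Push [0,1,2,3,4], Push [0,1,3,4,5], Move [2] [0,3,4,5,6], Move [1] [0,1,2,5,6],
    Move [1,6] [0,3,4], Move [5,6] [1,3,5], Move [1,2] [1,3,5], Move [2,4] [0,5,6], Move [1,4,6]
    [0,5,6], Move [2,4] [1,3,5], Move [3,4] [1,3,5], Push [1,3,5], Push [0], Push [0,1,2], Push
    [0,5,6], Push [0,1,2,5,6], Push [0,3,4]])) (Leaf [Push [0,1,2,3,4,5], Push [0,1,2,3,4], Push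
    [4], Push [0,3,4], Push [0,4,5,6], Push [0,1,2,3,5], Move [6] [0,1,3,5,6], Move [4,6]
    [0,1,2], Push [0,5,6], Push [0,1,2], Push [1,3,5], Push [1,3,4,5]])) (Branch [2] (Leaf [Push
    [1,3,5], Push [0,1,3,4], Push [1,4], Push [0,1,2], Push [0,5,6], Push [0,3,4], Push
    [0,3,4,5,6], Push [0,1,2,3,5]]) (Leaf [Push [0,1,3,5,6], Push [0,1,3,4,5], Push [0,1,3,4],
    Push [2], Push [1,4], Push [0,1,2], Push [1,3,4,5], Push [1,3,5], Push [0,5,6], Push
    [0,3,4], Push [0,2,3,4]]))) (Branch [4,5] (Leaf [Push [5], Push [0,5,6], Push [0,1,2,3,5,6],
    Push [0,1,3,5,6], Push [0,1,2,3,5], Push [0,1,2,5,6], Push [0,3,4,5,6], Push [0,1,2,5], Move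
    [2,4,6] [1,3,5], Push [0,3,4], Push [0,1,2], Push [1,3,5], Push [0,1,2,3,4]]) (Branch [1]
    (Leaf [Push [0,1,2,3,5], Push [5], Push [0,1,2,5,6], Push [4,5], Push [0,3,4,5,6], Push
    [0,1,2], Push [0,5,6], Push [0,3,4], Push [1,3,5], Push [1,3,4,5], Push [0,1,3,5,6], Push
    [0,1,2,3,4]]) (Branch [2,4,6] (Leaf [Push [1,3,4,5], Push [1,4,5], Push [0,1,2,3,5], Move
    [2] [0,3,4,5,6], Push [0,4,5,6], Move [6] [0,1,2,3,4], Move [2,6] [1,3,5], Move [0] [1,3,5],
    Push [1,3,5], Move [2,3] [0,5,6], Move [4,6] [0,1,3,4], Move [3,5] [0,5,6], Push [5], Push
    [1], Push [0,1,2], Push [0,3,4]]) (Leaf [Push [0,3,4], Push [0,1,3,5,6], Push [1], Push [5],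
    Push [0,5,6], Push [0,1,2], Push [1,3,5], Push [2,4,5,6], Push [1,5], Push [1,2,4,6]])))))
    (Branch [3,6] (Branch [4] (Leaf [Push [3], Push [1,3,5], Push [0,1,3,4,5,6], Push
    [0,3,4,5,6], Move [2,5] [0,3,4], Push [0,3,4], Push [0,5,6], Push [0,1,2], Push [0,1,2,5,6],
    Push [0,1,2,3], Push [0,1,2,3,4]]) (Leaf [Push [4], Push [3,4], Push [3], Push [0,3,5,6],
    Push [0,3,4], Push [1,3,5], Push [0,1,2], Push [0,5,6], Push [0,1,2,3], Push [1,3,4,5]]))
    (Branch [1,4] (Branch [4] (Leaf [Push [0,1,2,3,4,5], Move [0] [0,1,3,4,5], Move [2,3]
    [0,3,5,6], Move [2,6] [0,3,4,5,6], Move [1,6] [0,3,4,6], Move [2,3,4] [1,3,5,6], Move [1,3]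
    [0,3,4], Move [1,4,6] [0,5,6], Move [1,4,5] [0,5,6], Push [3,6], Push [3], Push [1,3,5],
    Push [0,5,6], Push [0,3,4], Push [0,1,2], Push [0,1,2,5,6]]) (Leaf [Push [4], Push [3,6],
    Push [1,3,5], Push [0,5,6], Push [0,3,4,5,6], Push [3], Push [0,3,4], Push [0,1,2], Push
    [1,3,5,6], Push [0,4,5,6]])) (Branch [5] (Leaf [Push [1,3,4,5], Push [0,3,4,5,6], Push
    [1,3,4], Push [3,6], Push [1,4], Move [0] [1,3,5], Push [1,3,5], Push [3], Push [0,3,4],
    Push [0,1,2], Push [0,5,6]]) (Branch [0] (Leaf [Push [3,5], Push [0,5,6], Push [1,4], Push
    [1,3,5], Push [0,3,4], Push [0,1,2], Push [0,3,5,6], Push [1,3,4,6], Push [3,6]]) (Leaf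
    [Push [0,3,5], Push [1,4], Push [3,6], Push [0,5,6], Push [0,1,2], Push [0,3,4,6], Push [5],
    Push [1,3,5], Push [0,3], Push [0,5], Push [1,3,4,5,6], Push [3,5]]))))))"
    by code_simp
  from fc_family_if_verify[OF this, of "[a, b, c, d, e, f, g]"] assms show ?thesis by simp
qed

text \<open>The Pasch configuration: any two of the triples meet, and each point lies on two of
  them. Its symmetry group is transitive on points, in accordance with the constant weights.\<close>

lemma fc_012_034_135_245:
  assumes "distinct [a, b, c, d, e, f]"
  shows "fc_family {{a, b, c}, {a, d, e}, {b, d, f}, {c, e, f}}"
proof -
  have "verify [[0, 1, 2], [0, 3, 4], [1, 3, 5], [2, 4, 5]] [1, 1, 1, 1, 1, 1]
    (Branch [2,3] (Branch [3] (Leaf [Push [0,3,4], Push [1,3,5], Push [0,1,2,3,4], Push [0,1,2],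
    Push [2,4,5], Push [0,2,3,4,5], Push [0,1,2,4,5], Push [0,1,2,3,5], Push [1,2,3,4,5]]) (Leaf
    [Push [2,4,5], Push [1,3,5], Push [0,3,4], Push [0,1,2]])) (Branch [4,5] (Leaf [Push
    [2,4,5], Push [2,3], Push [1,3,5], Push [0,3,4], Push [0,1,2], Push [0,1,2,4,5]]) (Leaf
    [Push [4,5], Push [1,3,5], Push [0,3,4], Push [2,3], Push [0,1,2]])))"
    by code_simp
  from fc_family_if_verify[OF this, of "[a, b, c, d, e, f]"] assms show ?thesis by simp
qed

text \<open>The Pasch configuration with one point split in two: the last two triples have become
  disjoint, while all other pairs of triples still meet.\<close>

lemma fc_012_034_135_246:
  assumes "distinct [a, b, c, d, e, f, g]"
  shows "fc_family {{a, b, c}, {a, d, e}, {b, d, f}, {c, e, g}}"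
proof -
  have "verify [[0, 1, 2], [0, 3, 4], [1, 3, 5], [2, 4, 6]] [2, 2, 2, 2, 2, 1, 1]
    (Branch [2] (Branch [4] (Branch [3] (Branch [0] (Leaf [Push [2,4,6], Move []
    [0,1,2,3,4,5,6], Move [6] [0,1,2,3,4], Push [0,2,3,4,6], Move [5,6] [0,1,3,4,5], Move [4,6]
    [1,3,5], Move [0,2] [0,3,4], Move [1,4] [0,1,2], Push [1,3,5], Push [0,3,4], Push [0,1,2],
    Push [0,1,2,3,5], Push [0,1,2,3,4], Push [0,1,2,4,6], Push [1,2,3,4,5,6]]) (Leaf [Push
    [0,1,3,4,5], Push [0], Push [1,3,5], Push [0,3,4], Push [2,4,6], Push [0,1,2], Push
    [0,2,3,4,6], Push [0,1,2,3,4], Push [0,1,2,3,5], Push [0,2,4,6], Push [1,2,3,4,5,6]]))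
    (Branch [0,5] (Leaf [Push [3], Push [2,4,6], Push [0,1,2], Push [0,3,4], Push [1,3,5], Push
    [0,1,3,4,5], Push [0,2,3,4,6], Push [0,1,2,4,6], Push [0,1,2,3,5]]) (Leaf [Push [3], Push
    [0,3,4], Push [2,4,6], Push [1,3,5], Push [0,1,2], Push [0,1,2,3,5], Push [0,1,3,4,5], Push
    [0,3,5], Push [2,3,4,6], Push [0,5]]))) (Branch [1,4] (Branch [0,5,6] (Leaf [Push [4], Push
    [2,4,6], Push [0,3,4], Push [1,3,5], Push [0,1,2], Push [0,1,2,3,5], Push [0,1,3,4,5], Push
    [0,1,2,4,6], Push [0,2,3,4,6]]) (Leaf [Push [2,4,6], Push [0,2,3,4,6], Push [4], Push
    [0,3,4], Push [1,3,5], Push [0,5,6], Push [0,1,2], Push [0,4,5,6]])) (Branch [2,6] (Leaf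
    [Push [0,1,2,3,5], Push [4], Move [5] [0,2,3,4,6], Move [5,6] [0,1,2,4,6], Move [0]
    [0,2,3,4,6], Move [6] [0,1,3,4,5], Move [3] [1,2,4,6], Push [1,2,4,6], Push [1,4], Push
    [1,3,5], Push [0,1,2], Push [0,3,4], Push [2,4,6]]) (Leaf [Push [4], Push [2,6], Push [1,4],
    Push [0,3,4], Push [0,1,2], Push [1,3,5], Push [1,3,4,5], Push [2,4,6], Push [0,1,2,4,6],
    Push [0,2,3,4,6], Push [1,2,4,6]])))) (Branch [2,3] (Branch [1] (Branch [2,3,5] (Leaf [Push
    [1,3,5], Push [0,1,3,4,5], Push [2], Push [2,4,6], Push [0,3,4], Push [0,1,2], Push
    [0,1,2,4,6], Push [0,1,2,3,5], Push [0,2,3,4,6]]) (Leaf [Push [2], Move [6] [0,1,3,4,5],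
    Push [0,1,2,4,6], Move [5,6] [0,1,2,3,5], Move [4] [1,2,3,5], Push [2,3,5], Push [2,4,6],
    Move [0,6] [1,3,5], Push [0,3,4], Push [0,1,2], Push [1,3,5]])) (Branch [0,5] (Leaf [Push
    [0,1,2,3,5], Push [2], Push [2,4,6], Push [0,1,2], Push [1,3,5], Push [0,2,3,4,6], Push
    [1,2], Push [1,2,4,6], Push [0,3,4], Push [0,1,3,4,5], Push [0,2,3,4], Push [0,1,2,4,6],
    Push [1,2,3,5]]) (Leaf [Push [1,2], Push [2,4,6], Push [1,3,5], Push [0,3,4], Push [0,2,5],
    Push [0,1,2,3,5], Push [0,1,5], Push [0,1,2], Push [0,1,3,4,5]]))) (Branch [1] (Branch
    [4,5,6] (Leaf [Push [2], Push [2,3], Push [0,3,4], Push [0,1,2], Push [2,4,6], Push [1,3,5],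
    Push [0,1,3,4,5], Push [0,1,2,4,6], Push [0,1,2,3,5], Push [0,2,3,4,6], Push [1,2,3,5], Push
    [2,3,4,6]]) (Leaf [Push [2,3,4,6], Push [2], Push [2,3], Push [0,1,2], Push [1,2,3,5], Push
    [4,5,6], Push [1,3,5], Push [0,3,4], Push [2,4,6]])) (Branch [0] (Leaf [Push [1], Push
    [1,3,5], Push [1,2,3,4,5,6], Move [5,6] [0,1,3,4,5], Move [6] [0,1,2,3,5], Move [5]
    [0,2,3,4,6], Push [2,3,4,6], Move [1,5] [0,1,2,4,6], Push [0,1,2,4,6], Move [0,5,6] [2,3],
    Push [0,1,2], Push [2,4,6], Push [2,3], Push [0,3,4], Push [1,2,3,5], Push [1,2]]) (Leaf
    [Push [0,1,3,4], Push [0,1,3,5], Push [0,1], Push [2,3,4,6], Push [0,1,2], Push [0,2,4,6],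
    Push [2,3], Push [0,2], Push [1], Push [1,3,5], Push [0,3,4], Push [1,2], Push [1,2,3,5],
    Push [0,2,3,4], Push [1,2,4,6]])))))"
    by code_simp
  from fc_family_if_verify[OF this, of "[a, b, c, d, e, f, g]"] assms show ?thesis by simp
qed

subsection \<open>Three triples on five points\<close>

lemma fc_family_mono: "fc_family G \<Longrightarrow> G \<subseteq> F \<Longrightarrow> fc_family F"
  by (meson fc_family_def subset_trans)

lemma triples_sharing_two:
  assumes "card A = 3" "card B = 3" "card (A \<inter> B) = 2"
  obtains a b c d where "distinct [a, b, c, d]" "A = {a, b, c}" "B = {a, b, d}"
proof -
  have fin: "finite A" "finite B" using assms by (auto intro: card_ge_0_finite)
  then have "card (A - B) = 1" "card (B - A) = 1"
    using assms by (simp_all add: card_Diff_subset_Int Int_commute)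
  then obtain c d where cd: "A - B = {c}" "B - A = {d}" by (auto simp: card_1_singleton_iff)
  obtain a b where ab: "A \<inter> B = {a, b}" "a \<noteq> b" using assms(3) by (auto simp: card_2_iff)
  have "A = {a, b, c}" "B = {a, b, d}" "distinct [a, b, c, d]" using ab cd by auto
  then show ?thesis using that by blast
qed

lemma triples_sharing_one:
  assumes "card A = 3" "card B = 3" "card (A \<inter> B) = 1"
  obtains a b c d e where "distinct [a, b, c, d, e]" "A = {a, b, c}" "B = {a, d, e}"
proof -
  have fin: "finite A" "finite B" using assms by (auto intro: card_ge_0_finite)
  then have "card (A - B) = 2" "card (B - A) = 2"
    using assms by (simp_all add: card_Diff_subset_Int Int_commute)
  then obtain b c d e where *: "A - B = {b, c}" "b \<noteq> c" "B - A = {d, e}" "d \<noteq> e"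
    by (auto simp: card_2_iff)
  obtain a where a: "A \<inter> B = {a}" using assms(3) by (auto simp: card_1_singleton_iff)
  have "A = {a, b, c}" "B = {a, d, e}" "distinct [a, b, c, d, e]" using a * by auto
  then show ?thesis using that by blast
qed

lemma card_Int_triples:
  assumes "card A = 3" "card B = 3" "A \<noteq> B"
  shows "card (A \<inter> B) \<le> 2"
proof -
  have fin: "finite A" "finite B" using assms by (auto intro: card_ge_0_finite)
  have "\<not> A \<subseteq> B" using card_subset_eq[OF fin(2), of A] assms by auto
  then have "A \<inter> B \<subset> A" by blast
  then have "card (A \<inter> B) < card A" using fin(1) by (rule psubset_card_mono[rotated])
  then show ?thesis using assms(1) by simp
qed

text \<open>At most one point of \<open>C\<close> is outside the four points of
  \<open>A \<union> B\<close>. Up to exchanging \<open>a\<close> with \<open>b\<close> and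
  \<open>c\<close> with \<open>d\<close>, either \<open>C\<close> is \<open>A \<union> B\<close>
  without \<open>b\<close>, or it is a fifth point with the pair \<open>{a, b}\<close>,
  \<open>{a, c}\<close> or \<open>{c, d}\<close>.\<close>

lemma fc_triples_sharing_two:
  assumes card: "card A = 3" "card B = 3" "card C = 3" and AB: "card (A \<inter> B) = 2"
    and ne: "C \<noteq> A" "C \<noteq> B" and U: "card (A \<union> B \<union> C) \<le> 5"
  shows "fc_family {A, B, C}"
proof -
  obtain a b c d where dist: "distinct [a, b, c, d]" and A: "A = {a, b, c}" and B: "B = {a, b, d}"
    using triples_sharing_two[OF card(1,2) AB] .
  have finC: "finite C" using card by (auto intro: card_ge_0_finite)
  let ?S = "{a, b, c, d}"
  have "card (A \<union> B \<union> C) = card ?S + card (C - ?S)"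
    using finC by (subst card_Un_disjoint[symmetric]) (auto simp: A B intro: arg_cong[of _ _ card])
  then have le: "card (C - ?S) \<le> 1" using U dist by simp
  show ?thesis
  proof (cases "C \<subseteq> ?S")
    case True
    have "card (?S - C) = 1" using True finC dist card by (simp add: card_Diff_subset)
    then obtain z where z: "?S - C = {z}" by (auto simp: card_1_singleton_iff)
    then have C: "C = ?S - {z}" using double_diff[OF True order_refl] by simp
    have "z \<in> ?S" using z by auto
    \<comment> \<open>Omitting \<open>c\<close> would give \<open>B\<close>, and omitting
      \<open>d\<close> would give \<open>A\<close>.\<close>
    moreover have "z \<noteq> c" "z \<noteq> d" using ne C dist by (auto simp: A B)
    ultimately consider "z = b" | "z = a" by auto
    then consider "C = {a, c, d}" | "C = {b, c, d}"
      using C dist by cases (force simp: insert_Diff_if)+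
    then show ?thesis
    proof cases
      case 1
      then show ?thesis using fc_012_013_023[of a b c d] dist by (auto simp: A B)
    next
      case 2
      then show ?thesis using fc_012_013_023[of b a c d] dist by (auto simp: A B insert_commute)
    qed
  next
    case False
    then have "card (C - ?S) = 1" using le finC by (metis Diff_eq_empty_iff card_0_eq finite_Diff le_antisym less_one not_le)
    then obtain e where e: "C - ?S = {e}" by (auto simp: card_1_singleton_iff)
    then have "e \<in> C" "e \<notin> ?S" by blast+
    then have "card (C - {e}) = 2" using card by simp
    then obtain x y where xy: "C - {e} = {x, y}" "x \<noteq> y" by (auto simp: card_2_iff)
    have C: "C = {x, y, e}" using xy(1) \<open>e \<in> C\<close> by (metis insert_Diff insert_commute)
    have "C - {e} \<subseteq> ?S" using e by blast
    then have S: "x \<in> ?S" "y \<in> ?S" unfolding xy(1) by blast+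
    have de: "distinct [a, b, c, d, e]" using dist \<open>e \<notin> ?S\<close> by auto
    from S xy(2) consider "{x, y} = {a, b}" | "{x, y} = {a, c}" | "{x, y} = {a, d}"
      | "{x, y} = {b, c}" | "{x, y} = {b, d}" | "{x, y} = {c, d}"
      by (elim insertE emptyE) (simp_all add: insert_commute)
    then consider "C = {a, b, e}" | "C = {a, c, e}" | "C = {a, d, e}"
      | "C = {b, c, e}" | "C = {b, d, e}" | "C = {c, d, e}"
      unfolding C by cases (metis insert_commute)+
    then show ?thesis
    proof cases
      case 1
      then show ?thesis using fc_012_013_014[of a b c d e] de by (auto simp: A B)
    next
      case 2
      then show ?thesis using fc_012_013_024[of a b c d e] de by (auto simp: A B)
    next
      case 3
      then show ?thesis using fc_012_013_024[of a b d c e] de by (auto simp: A B insert_commute)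
    next
      case 4
      then show ?thesis using fc_012_013_024[of b a c d e] de by (auto simp: A B insert_commute)
    next
      case 5
      then show ?thesis using fc_012_013_024[of b a d c e] de by (auto simp: A B insert_commute)
    next
      case 6
      then show ?thesis using fc_012_013_234[of a b c d e] de by (auto simp: A B)
    qed
  qed
qed

lemma fc_three_triples:
  assumes card: "card A = 3" "card B = 3" "card C = 3" and ne: "A \<noteq> B" "A \<noteq> C" "B \<noteq> C"
    and U: "card (A \<union> B \<union> C) \<le> 5"
  shows "fc_family {A, B, C}"
proof -
  have fin: "finite A" "finite B" "finite C" using card by (auto intro: card_ge_0_finite)
  consider "card (A \<inter> B) = 2" | "card (A \<inter> C) = 2" | "card (B \<inter> C) = 2"
    | "card (A \<inter> B) \<le> 1" "card (A \<inter> C) \<le> 1" "card (B \<inter> C) \<le> 1"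
    using card_Int_triples[of A B] card_Int_triples[of A C] card_Int_triples[of B C] card ne
    by linarith
  then show ?thesis
  proof cases
    case 1
    then show ?thesis using fc_triples_sharing_two[of A B C] card ne U by auto
  next
    case 2
    then show ?thesis using fc_triples_sharing_two[of A C B] card ne U
      by (auto simp: insert_commute Un_ac)
  next
    case 3
    then show ?thesis using fc_triples_sharing_two[of B C A] card ne U
      by (auto simp: insert_commute Un_ac)
  next
    case 4
    \<comment> \<open>With pairwise intersections of at most one point the union has at least 9 - 3
      = 6 points, one too many.\<close>
    have "card (A \<union> B) = 6 - card (A \<inter> B)"
      using card_Un_Int[OF fin(1,2)] card by simp
    moreover have "card (A \<union> B \<union> C) + card ((A \<union> B) \<inter> C) = card (A \<union> B) + card C"
      using card_Un_Int[of "A \<union> B" C] fin by simp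
    moreover have "card ((A \<union> B) \<inter> C) \<le> card (A \<inter> C) + card (B \<inter> C)"
      using card_Un_le[of "A \<inter> C" "B \<inter> C"] by (simp add: Int_Un_distrib2)
    ultimately have False using 4 U card by linarith
    then show ?thesis ..
  qed
qed

subsection \<open>Four triples on seven points\<close>

text \<open>The sixteen choices of \<open>(x, y)\<close> form five orbits under exchanging
  \<open>a\<close> with \<open>b\<close>, \<open>c\<close> with \<open>d\<close>, and
  \<open>(x, f)\<close> with \<open>(y, g)\<close>. If \<open>x = y\<close> is \<open>c\<close> or
  \<open>d\<close>, the pair \<open>{x, e}\<close> takes over the role of
  \<open>{a, b}\<close>.\<close>

lemma fc_two_pairs_sharing_two:
  assumes "distinct [a, b, c, d, e, f, g]" "x \<in> {a, b, c, d}" "y \<in> {a, b, c, d}"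
  shows "fc_family {{a, b, c}, {a, b, d}, {x, e, f}, {y, e, g}}"
proof -
  have "\<forall>x\<in>{a, b, c, d}. \<forall>y\<in>{a, b, c, d}. fc_family {{a, b, c}, {a, b, d}, {x, e, f}, {y, e, g}}"
    apply (simp only: ball_simps)
    apply (intro conjI TrueI)
    subgoal using fc_012_013_045_046[of a b c d e f g] assms(1) by (auto simp: insert_commute)
    subgoal using fc_012_013_045_146[of a b c d e f g] assms(1) by (auto simp: insert_commute)
    subgoal using fc_012_013_045_246[of a b c d e f g] assms(1) by (auto simp: insert_commute)
    subgoal using fc_012_013_045_246[of a b d c e f g] assms(1) by (auto simp: insert_commute)
    subgoal using fc_012_013_045_146[of b a c d e f g] assms(1) by (auto simp: insert_commute)
    subgoal using fc_012_013_045_046[of b a c d e f g] assms(1) by (auto simp: insert_commute)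
    subgoal using fc_012_013_045_246[of b a c d e f g] assms(1) by (auto simp: insert_commute)
    subgoal using fc_012_013_045_246[of b a d c e f g] assms(1) by (auto simp: insert_commute)
    subgoal using fc_012_013_045_246[of a b c d e g f] assms(1) by (auto simp: insert_commute)
    subgoal using fc_012_013_045_246[of b a c d e g f] assms(1) by (auto simp: insert_commute)
    subgoal using fc_012_013_045_456[of c e f g a b d] assms(1) by (auto simp: insert_commute)
    subgoal using fc_012_013_245_346[of a b c d e f g] assms(1) by (auto simp: insert_commute)
    subgoal using fc_012_013_045_246[of a b d c e g f] assms(1) by (auto simp: insert_commute)
    subgoal using fc_012_013_045_246[of b a d c e g f] assms(1) by (auto simp: insert_commute)
    subgoal using fc_012_013_245_346[of a b d c e f g] assms(1) by (auto simp: insert_commute)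
    subgoal using fc_012_013_045_456[of d e f g a b c] assms(1) by (auto simp: insert_commute)
    done
  then show ?thesis using assms(2,3) by blast
qed

section \<open>A hypothetical family of four triples that is not FC\<close>

locale four_triples =
  fixes Fc :: "'a set set"
  assumes card_Fc: "card Fc = 4" and card_3: "A \<in> Fc \<Longrightarrow> card A = 3"
    and card_Union: "card (\<Union> Fc) \<le> 7" and not_fc: "\<not> fc_family Fc"
begin

lemma finite_Fc: "finite Fc"
  using card_Fc by (auto intro: card_ge_0_finite)

lemma finite_member: "A \<in> Fc \<Longrightarrow> finite A"
  using card_3 by (auto intro: card_ge_0_finite)

lemma finite_Union: "finite (\<Union> Fc)"
  using finite_Fc finite_member by auto

text \<open>Otherwise three members would form an FC-family, and this property passes to every
  larger family.\<close>

lemma three_spread: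
  assumes "A \<in> Fc" "B \<in> Fc" "C \<in> Fc" "A \<noteq> B" "A \<noteq> C" "B \<noteq> C"
  shows "6 \<le> card (A \<union> B \<union> C)"
proof (rule ccontr)
  assume "\<not> ?thesis"
  then have "fc_family {A, B, C}"
    using assms card_3 by (intro fc_three_triples) auto
  then show False using not_fc fc_family_mono[of "{A, B, C}" Fc] assms by auto
qed

lemma Fc_eq:
  assumes "A \<in> Fc" "B \<in> Fc" "A \<noteq> B"
  obtains C D where "Fc = {A, B, C, D}" "distinct [A, B, C, D]"
proof -
  have "card (Fc - {A, B}) = 2"
    using assms card_Fc finite_Fc by (simp add: card_Diff_subset)
  then obtain C D where CD: "Fc - {A, B} = {C, D}" "C \<noteq> D" by (auto simp: card_2_iff)
  have "Fc = {A, B} \<union> (Fc - {A, B})" using assms by auto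
  then have "Fc = {A, B, C, D}" using CD by auto
  moreover have "distinct [A, B, C, D]" using CD assms by auto
  ultimately show ?thesis using that by blast
qed

text \<open>Suppose that \<open>A\<close> and \<open>B\<close> share two points. Outside the four
  points of \<open>S = A \<union> B\<close> there is a set \<open>R\<close> of at most three, and
  \<open>three_spread\<close> puts at least two points of \<open>C\<close> and of \<open>D\<close>
  into \<open>R\<close>. Either one of them equals \<open>R\<close>, or both meet \<open>R\<close>
  in the same pair, or in two pairs with one common point.\<close>

lemma card_Int_ne_2:
  assumes "A \<in> Fc" "B \<in> Fc"
  shows "card (A \<inter> B) \<noteq> 2"
proof
  assume AB: "card (A \<inter> B) = 2"
  then have ne: "A \<noteq> B" using card_3 assms by force
  obtain C D where Fc: "Fc = {A, B, C, D}" and dF: "distinct [A, B, C, D]"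
    using Fc_eq[OF assms ne] .
  obtain a b c d where dist: "distinct [a, b, c, d]" and A: "A = {a, b, c}" and B: "B = {a, b, d}"
    using triples_sharing_two[OF card_3 card_3 AB] assms by metis
  define S where "S = {a, b, c, d}"
  define R where "R = \<Union> Fc - S"
  have S: "A \<union> B = S" by (auto simp: S_def A B)
  have "card S = 4" using dist by (simp add: S_def)
  have "S \<subseteq> \<Union> Fc" using assms S by blast
  then have "card R \<le> 3"
    using finite_Union \<open>card S = 4\<close> card_Union by (simp add: R_def card_Diff_subset finite_subset)
  have finR: "finite R" using finite_Union by (simp add: R_def)
  have part: "(\<exists>x\<in>S. \<exists>T\<subseteq>R. card T = 2 \<and> X = insert x T) \<or> (X = R \<and> card R = 3)"
    if X: "X \<in> Fc" "X \<noteq> A" "X \<noteq> B" for X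
  proof -
    have finX: "finite X" using X finite_member by simp
    have sub: "X - S \<subseteq> R" using X by (auto simp: R_def)
    have "card (S \<union> X) = card S + card (X - S)"
      using finX by (subst card_Un_disjoint[symmetric]) (auto simp: S_def intro: arg_cong[of _ _ card])
    then have ge: "2 \<le> card (X - S)"
      using three_spread[OF assms X(1) ne] X \<open>card S = 4\<close> S by auto
    have cX: "card X = 3" using X card_3 by simp
    show ?thesis
    proof (cases "X \<subseteq> R")
      case True
      then have "card R = 3" using card_mono[OF finR True] cX \<open>card R \<le> 3\<close> by simp
      then show ?thesis using card_subset_eq[OF finR True] cX by simp
    next
      case False
      then have "X - S \<noteq> X" using sub by auto
      then obtain x where x: "x \<in> X" "x \<in> S" by blast
      have "card (X - S) \<le> card (X - {x})" using finX x by (intro card_mono) auto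
      moreover have 2: "card (X - {x}) = 2" using x cX by simp
      ultimately have "X - S = X - {x}"
        using ge finX x(2) by (intro card_seteq) auto
      then have eq: "X - {x} \<subseteq> R" using sub by simp
      have "X = insert x (X - {x})" using x by auto
      then show ?thesis using x(2) 2 eq by blast
    qed
  qed
  have fin2: "finite T" if "card T = 2" for T :: "'a set" using that by (auto intro: card_ge_0_finite)
  have goal: False if "fc_family {A, B, C, D}" using that not_fc Fc by simp
  \<comment> \<open>The case that \<open>R\<close> is a member. What matters about the other triple
    is whether its point \<open>y\<close> in \<open>S\<close> lies in both \<open>A\<close> and
    \<open>B\<close> or in just one of them.\<close>
  have full: False
    if full: "X = R" "card R = 3" and Y: "y \<in> S" "T \<subseteq> R" "card T = 2" "Y = insert y T"
      and XY: "Fc = {A, B, X, Y}" for X Y T y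
  proof -
    obtain e f where T: "T = {e, f}" "e \<noteq> f" using Y(3) by (auto simp: card_2_iff)
    have "card (R - T) = 1"
      using Y(2,3) full(2) fin2[OF Y(3)] by (simp add: card_Diff_subset)
    then obtain g where g: "R - T = {g}" by (auto simp: card_1_singleton_iff)
    have R: "R = {e, f, g}" using g T Y(2) by blast
    have "g \<notin> {e, f}" using g T by blast
    moreover have "{e, f, g} \<inter> S = {}" using R by (auto simp: R_def)
    ultimately have de: "distinct [a, b, c, d, e, f, g]" using dist T by (auto simp: S_def)
    have "y = a \<or> y = b \<or> y = c \<or> y = d" using Y(1) by (simp add: S_def)
    then have "fc_family {{a, b, c}, {a, b, d}, {e, f, g}, {y, e, f}}"
      using fc_012_013_045_456[of a b c d e f g] fc_012_013_045_456[of b a c d e f g]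
        fc_012_013_245_456[of a b c d e f g] fc_012_013_245_456[of a b d c e f g] de
      by (elim disjE) (auto simp: insert_commute)
    then show False using not_fc XY A B full(1) R Y(4) T(1) by simp
  qed
  have mem: "C \<in> Fc" "C \<noteq> A" "C \<noteq> B" "D \<in> Fc" "D \<noteq> A" "D \<noteq> B" "C \<noteq> D"
    using Fc dF by auto
  have swap: "Fc = {A, B, D, C}" using Fc by (simp add: insert_commute)
  consider "C = R" "card R = 3" | "D = R" "card R = 3"
    | x y T T' where "x \<in> S" "T \<subseteq> R" "card T = 2" "C = insert x T"
      "y \<in> S" "T' \<subseteq> R" "card T' = 2" "D = insert y T'"
    using part[OF mem(1-3)] part[OF mem(4-6)] by blast
  then show False
  proof cases
    case 1
    then show False using part[OF mem(4-6)] full[OF 1 _ _ _ _ Fc] mem by blast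
  next
    case 2
    then show False using part[OF mem(1-3)] full[OF 2 _ _ _ _ swap] mem by blast
  next
    case (3 x y T T')
    have fT: "finite T" "finite T'" using 3 fin2 by auto
    have dS: "T \<inter> S = {}" "T' \<inter> S = {}" using 3 by (auto simp: R_def)
    show False
    proof (cases "T = T'")
      case True
      obtain e f where T: "T = {e, f}" "e \<noteq> f" using 3(3) by (auto simp: card_2_iff)
      have xy: "x \<noteq> y" using mem(7) 3 True by auto
      have de: "distinct [a, b, c, d, e, f]" using dist T dS by (auto simp: S_def)
      \<comment> \<open>If \<open>x\<close> and \<open>y\<close> were both in \<open>A\<close>, then
        \<open>A\<close>, \<open>C\<close>, \<open>D\<close> would span only
        \<open>A \<union> T\<close>, at most five points; likewise for \<open>B\<close>. This leaves
        \<open>{x, y} = {c, d}\<close>.\<close>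
      have "\<not> {x, y} \<subseteq> X" if X: "X = A \<or> X = B" for X
      proof
        assume "{x, y} \<subseteq> X"
        then have "X \<union> C \<union> D = X \<union> T" using 3 True by auto
        moreover have "card (X \<union> T) \<le> 5"
          using card_Un_le[of X T] 3(3) card_3[of X] X assms by auto
        ultimately show False
          using three_spread[of X C D] X assms mem by auto
      qed
      from this[of A] this[of B] have "\<not> {x, y} \<subseteq> A" "\<not> {x, y} \<subseteq> B" by auto
      then have "(x = c \<and> y = d) \<or> (x = d \<and> y = c)"
        using 3(1,5) xy by (auto simp: S_def A B)
      then have "fc_family {{a, b, c}, {a, b, d}, {x, e, f}, {y, e, f}}"
        using fc_012_013_245_345[of a b c d e f] de by (auto simp: insert_commute)
      then show False using goal A B 3 T True by simp
    next
      case False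
      \<comment> \<open>Two distinct pairs among at most three points have exactly one point in
        common.\<close>
      have "card (T \<union> T') \<le> 3" using 3 finR \<open>card R \<le> 3\<close> card_mono[OF finR, of "T \<union> T'"] by simp
      moreover have "card (T \<union> T') + card (T \<inter> T') = 4" using card_Un_Int[OF fT] 3 by simp
      ultimately have "1 \<le> card (T \<inter> T')" by simp
      moreover have "card (T \<inter> T') < 2"
        using False 3 fT psubset_card_mono[of T "T \<inter> T'"] card_subset_eq[of T' T] by auto
      ultimately have "card (T \<inter> T') = 1" by simp
      then obtain e where e: "T \<inter> T' = {e}" by (auto simp: card_1_singleton_iff)
      then have "e \<in> T" "e \<in> T'" by blast+
      then have "card (T - {e}) = 1" "card (T' - {e}) = 1" using 3 by simp_all
      then obtain f g where fg: "T - {e} = {f}" "T' - {e} = {g}" by (auto simp: card_1_singleton_iff)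
      have T: "T = {e, f}" "T' = {e, g}" using e fg by auto
      have de: "distinct [a, b, c, d, e, f, g]" using dist T dS fg e by (auto simp: S_def)
      have "fc_family {{a, b, c}, {a, b, d}, {x, e, f}, {y, e, g}}"
        using fc_two_pairs_sharing_two[OF de] 3(1,5) by (simp add: S_def)
      then show False using goal A B 3 T by simp
    qed
  qed
qed

lemma card_Int_le_1:
  assumes "A \<in> Fc" "B \<in> Fc" "A \<noteq> B"
  shows "card (A \<inter> B) \<le> 1"
  using card_Int_triples[OF card_3 card_3, of A B] card_Int_ne_2[of A B] assms by linarith

lemma common_point:
  assumes "A \<in> Fc" "B \<in> Fc" "A \<noteq> B" "x \<in> A" "x \<in> B" "y \<in> A" "y \<in> B"
  shows "x = y"
proof -
  have "A \<inter> B \<subseteq> {x}"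
    using card_Int_le_1[OF assms(1-3)] finite_member[OF assms(1)] assms(4,5)
    by (auto simp: card_le_Suc0_iff_eq)
  then show ?thesis using assms by auto
qed

text \<open>Members now meet in at most one point, and four disjoint triples would need twelve
  points, so some \<open>A\<close> and \<open>B\<close> meet, in \<open>a\<close> say. Any other
  member contains two points outside \<open>A \<union> B\<close>, or it is a transversal: one point
  of \<open>A - {a}\<close>, one of \<open>B - {a}\<close>, one outside. Only two points are left
  outside, so \<open>C\<close> and \<open>D\<close> cannot both be of the former kind without
  sharing these two.\<close>

lemma contradiction: False
proof -
  have "\<exists>A\<in>Fc. \<exists>B\<in>Fc. A \<noteq> B \<and> A \<inter> B \<noteq> {}"
  proof (rule ccontr)
    assume "\<not> ?thesis"
    then have "card (\<Union> Fc) = sum card Fc"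
      using finite_member by (intro card_Union_disjoint) (auto simp: pairwise_def disjnt_def)
    also have "\<dots> = 12" using card_3 card_Fc by simp
    finally show False using card_Union by simp
  qed
  then obtain A B where AB: "A \<in> Fc" "B \<in> Fc" "A \<noteq> B" "A \<inter> B \<noteq> {}" by blast
  then have "card (A \<inter> B) = 1"
    using card_Int_le_1[OF AB(1-3)] finite_member[OF AB(1)]
    by (metis One_nat_def card_gt_0_iff finite_Int le_antisym Suc_leI)
  then obtain a b c d e where dist0: "distinct [a, b, c, d, e]" and A: "A = {a, b, c}" and B: "B = {a, d, e}"
    using triples_sharing_one[of A B] card_3 AB by metis
  obtain C D where Fc: "Fc = {A, B, C, D}" and dF: "distinct [A, B, C, D]"
    using Fc_eq[OF AB(1-3)] .
  define R where "R = \<Union> Fc - {a, b, c, d, e}"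
  have finR: "finite R" using finite_Union by (simp add: R_def)
  have "{a, b, c, d, e} \<subseteq> \<Union> Fc" using AB(1,2) A B by blast
  then have cR: "card R \<le> 2"
    using dist0 card_Union by (simp add: R_def card_Diff_subset)
  have shape: "(\<exists>z\<in>{a, b, c, d, e}. X = insert z R \<and> card R = 2)
      \<or> (\<exists>p\<in>{b, c}. \<exists>q\<in>{d, e}. \<exists>r\<in>R. X = {p, q, r})"
    if X: "X \<in> Fc" "X \<noteq> A" "X \<noteq> B" for X
  proof -
    have finX: "finite X" using X finite_member by simp
    have 3: "card X = 3" using X card_3 by simp
    have sub: "X \<subseteq> {a, b, c, d, e} \<union> R" using X by (auto simp: R_def)
    have "\<not> X \<subseteq> R" using card_mono[OF finR, of X] cR 3 by auto
    then obtain z where z: "z \<in> X" "z \<notin> R" by blast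
    have c2: "card (X - {z}) = 2" using z 3 by simp
    show ?thesis
    proof (cases "X - {z} \<subseteq> R")
      case True
      then have "X - {z} = R" "card R = 2"
        using c2 cR finR card_mono[OF finR True] card_subset_eq[OF finR True] by simp_all
      then show ?thesis using z sub by auto
    next
      case False
      then obtain w where w: "w \<in> X" "w \<noteq> z" "w \<notin> R" by blast
      have XA: "x = y" if "x \<in> X" "y \<in> X" "x \<in> A" "y \<in> A" for x y
        using common_point[OF X(1) AB(1) X(2)] that by blast
      have XB: "x = y" if "x \<in> X" "y \<in> X" "x \<in> B" "y \<in> B" for x y
        using common_point[OF X(1) AB(2) X(3)] that by blast
      have zw: "z \<in> A \<union> B" "w \<in> A \<union> B" using z w sub A B by auto
      then have pq: "(z \<in> A - B \<and> w \<in> B - A) \<or> (w \<in> A - B \<and> z \<in> B - A)"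
        using XA[of z w] XB[of z w] z w by blast
      then obtain p q where p: "p \<in> X" "p \<in> A - B" and q: "q \<in> X" "q \<in> B - A" using z w by blast
      have "p \<noteq> q" using p q by blast
      have "card (X - {p, q}) = 1" using 3 p q \<open>p \<noteq> q\<close> by (simp add: card_Diff_subset)
      then obtain r where r: "X - {p, q} = {r}" by (auto simp: card_1_singleton_iff)
      have X_eq: "X = {p, q, r}" using r p q by blast
      have "r \<notin> A" "r \<notin> B" using XA[of p r] XB[of q r] p q r by blast+
      then have "r \<in> R" using sub r A B by blast
      moreover have "p \<in> {b, c}" "q \<in> {d, e}" using p q by (auto simp: A B)
      ultimately show ?thesis using X_eq by blast
    qed
  qed
  \<comment> \<open>\<open>Y\<close> is the transversal. Writing \<open>p'\<close> and
    \<open>q'\<close> for the partners of \<open>p\<close> in \<open>A\<close> and of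
    \<open>q\<close> in \<open>B\<close> treats the four choices of \<open>(p, q)\<close> as
    one.\<close>
  have finish: False
    if "X \<in> Fc" "X \<noteq> A" "X \<noteq> B" "Y \<in> Fc" "Y \<noteq> A" "Y \<noteq> B" "X \<noteq> Y" and Fc: "Fc = {A, B, X, Y}"
      and Y: "p \<in> {b, c}" "q \<in> {d, e}" "f \<in> R" "Y = {p, q, f}" for X Y p q f
  proof -
    obtain p' where p': "{b, c} = {p, p'}" "p \<noteq> p'" using Y(1) dist0 by auto
    obtain q' where q': "{d, e} = {q, q'}" "q \<noteq> q'" using Y(2) dist0 by auto
    have A': "A = {a, p, p'}" and B': "B = {a, q, q'}" using A B p' q' by simp_all
    have f: "f \<notin> {a, p, p', q, q'}" using Y(3) p' q' by (auto simp: R_def)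
    have five: "{a, b, c, d, e} = {a, p, p', q, q'}" using p' q' by auto
    have "card {a, p, p', q, q'} = 5" unfolding five[symmetric] using dist0 by simp
    then have dist: "distinct [a, p, p', q, q']" by (intro card_distinct) simp
    have XY: "x = y" if "x \<in> X" "y \<in> X" "x \<in> Y" "y \<in> Y" for x y
      using common_point[of X Y] \<open>X \<in> Fc\<close> \<open>Y \<in> Fc\<close> \<open>X \<noteq> Y\<close> that by blast
    have not_fc': "\<not> fc_family {{a, p, p'}, {a, q, q'}, X, {p, q, f}}"
      using not_fc unfolding Fc A' B' Y(4) .
    from shape[OF that(1-3)] show False
    proof (elim disjE bexE conjE)
      fix z assume z: "z \<in> {a, b, c, d, e}" and X: "X = insert z R" and "card R = 2"
      then have "card (R - {f}) = 1" using Y(3) by simp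
      then obtain g where g: "R - {f} = {g}" by (auto simp: card_1_singleton_iff)
      then have R: "R = {f, g}" using Y(3) by blast
      have "g \<in> R" "f \<noteq> g" using g by blast+
      then have de: "distinct [a, p, p', q, q', f, g]"
        using dist f unfolding R_def five by auto
      \<comment> \<open>\<open>X\<close> and \<open>Y\<close> already share
        \<open>f\<close>.\<close>
      have "z \<noteq> p" "z \<noteq> q" using XY[of p f] XY[of q f] f X R Y(4) by auto
      then have "z = a \<or> z = p' \<or> z = q'" using z unfolding five by blast
      then have "fc_family {{a, p, p'}, {a, q, q'}, {z, f, g}, {p, q, f}}"
        using fc_012_034_056_135[of a p p' q q' f g]
          fc_012_034_135_246[of p a p' q f q' g] fc_012_034_135_246[of q a q' p f p' g] de
        by (elim disjE) (auto simp: insert_commute)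
      then show False using not_fc' X R by simp
    next
      fix u v g assume uv: "u \<in> {b, c}" "v \<in> {d, e}" "g \<in> R" "X = {u, v, g}"
      have uv': "u = p \<or> u = p'" "v = q \<or> v = q'" using uv p' q' by auto
      have g: "g \<notin> {a, p, p', q, q'}" using uv(3) unfolding R_def five by blast
      have ne: "\<not> (u = p \<and> v = q)" using XY[of p q] uv(4) Y(4) dist by auto
      show False
      proof (cases "g = f")
        case True
        then have "u \<noteq> p" "v \<noteq> q" using XY[of p f] XY[of q f] uv(4) Y(4) f by auto
        then have "X = {p', q', f}" using uv' uv(4) True by simp
        then show False
          using fc_012_034_135_245[of a p p' q q' f] dist f not_fc' by (auto simp: insert_commute)
      next
        case False
        then have de: "distinct [a, p, p', q, q', f, g]" using dist f g by auto
        \<comment> \<open>If \<open>X\<close> passes through \<open>p\<close>, three triples contain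
          \<open>p\<close> and \<open>{a, q, q'}\<close> is their transversal; symmetrically for
          \<open>q\<close>. Otherwise \<open>X = {p', q', g}\<close> is disjoint from
          \<open>Y\<close>.\<close>
        have "fc_family {{a, p, p'}, {a, q, q'}, {u, v, g}, {p, q, f}}"
          using fc_012_034_056_135[of p a p' q f q' g] fc_012_034_056_135[of q a q' p f p' g]
            fc_012_034_135_246[of a p p' q q' f g] de uv' ne
          by (elim disjE) (auto simp: insert_commute)
        then show False using not_fc' uv(4) by simp
      qed
    qed
  qed
  have mem: "C \<in> Fc" "C \<noteq> A" "C \<noteq> B" "D \<in> Fc" "D \<noteq> A" "D \<noteq> B" "C \<noteq> D"
    using Fc dF by auto
  have swap: "Fc = {A, B, D, C}" using Fc by (simp add: insert_commute)
  from shape[OF mem(4-6)] show False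
  proof (elim disjE bexE conjE)
    fix p q f assume "p \<in> {b, c}" "q \<in> {d, e}" "f \<in> R" "D = {p, q, f}"
    then show False using finish[OF mem Fc] by blast
  next
    fix z assume D: "D = insert z R" "card R = 2"
    from shape[OF mem(1-3)] show False
    proof (elim disjE bexE conjE)
      fix p q f assume "p \<in> {b, c}" "q \<in> {d, e}" "f \<in> R" "C = {p, q, f}"
      then show False using finish[OF mem(4-6,1-3) mem(7)[symmetric] swap] by blast
    next
      fix y assume "C = insert y R"
      then have "R \<subseteq> C \<inter> D" using D by blast
      then have "card R \<le> card (C \<inter> D)"
        using finite_member[OF mem(1)] by (intro card_mono) auto
      then show False using card_Int_le_1[OF mem(1,4,7)] D(2) by simp
    qed
  qed
qed

end

section \<open>FC-families of three and of four triples\<close>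

lemma fc_family_four_triples:
  assumes "card Fc = 4" "\<And>A. A \<in> Fc \<Longrightarrow> card A = 3" "card (\<Union> Fc) \<le> 7"
  shows "fc_family Fc"
  using four_triples.contradiction[of Fc] assms by (auto simp: four_triples_def)

lemma fc_family_three_triples:
  assumes "card Fc = 3" "\<And>A. A \<in> Fc \<Longrightarrow> card A = 3" "card (\<Union> Fc) \<le> 5"
  shows "fc_family Fc"
proof -
  obtain A B C where "Fc = {A, B, C}" "A \<noteq> B" "B \<noteq> C" "A \<noteq> C"
    using assms(1) by (auto simp: card_3_iff)
  then show ?thesis using assms(2,3) fc_three_triples[of A B C] by (simp add: Un_assoc)
qed

theorem theorem3:
  shows "(\<forall>a::'a. fc_family {{a}})
    \<and> (\<forall>a b::'a. a \<noteq> b \<longrightarrow> fc_family {{a, b}})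
    \<and> (\<forall>Fc::'a set set. card Fc = 3 \<and> (\<forall>A\<in>Fc. card A = 3) \<and> card (\<Union>Fc) \<le> 5
          \<longrightarrow> fc_family Fc)
    \<and> (\<forall>Fc::'a set set. card Fc = 4 \<and> (\<forall>A\<in>Fc. card A = 3) \<and> card (\<Union>Fc) \<le> 6
          \<longrightarrow> fc_family Fc)
    \<and> (\<forall>Fc::'a set set. card Fc = 4 \<and> (\<forall>A\<in>Fc. card A = 3) \<and> card (\<Union>Fc) \<le> 7
          \<longrightarrow> fc_family Fc)"
proof (intro conjI allI impI; (elim conjE)?)
  show "fc_family Fc" if "card Fc = 3" "\<forall>A\<in>Fc. card A = 3" "card (\<Union> Fc) \<le> 5" for Fc :: "'a set set"
    using that by (intro fc_family_three_triples) auto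
  show "fc_family Fc" if "card Fc = 4" "\<forall>A\<in>Fc. card A = 3" "card (\<Union> Fc) \<le> 7" for Fc :: "'a set set"
    using that by (intro fc_family_four_triples) auto
  then show "fc_family Fc" if "card Fc = 4" "\<forall>A\<in>Fc. card A = 3" "card (\<Union> Fc) \<le> 6" for Fc :: "'a set set"
    using that by simp
qed (fact fc_family_singleton, erule fc_family_pair)

end
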